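(* Let $N\ge 2$, let $\Omega\subset\mathbb{R}^N$ be a bounded convex domain, and let $f$ be a positive $C^1$ function of one real variable, defined on an interval containing $u(\overline\Omega)$, where $u\in C^3(\Omega)\cap C^2(\overline\Omega)$ is an admissible solution of $$S_2(D^2u)=f(u)\ \text{ in }\Omega,\qquad u=0\ \text{ on }\partial\Omega .$$ Assume that $f'\le 0$ and that $\alpha\in[1,\infty)$. Assume further that there exists a strictly increasing $C^2$ function $U$, defined on an interval $I\supset u(\Omega)$, such that the composition $\mathbf{x}\mapsto U(u(\mathbf{x}))$ is convex in $\Omega$. Then the function $$\Phi(\mathbf{x},\alpha):=|\nabla u(\mathbf{x})|^2+2\alpha\int_{u(\mathbf{x})}^{0} f^{1/2}(s)\,ds,\qquad \mathbf{x}\in\overline\Omega,$$ attains its minimum value over $\overline\Omega$ on $\partial\Omega$, that is, $\min_{\overline\Omega}\Phi(\cdot,\alpha)=\min_{\partial\Omega}\Phi(\cdot,\alpha)$.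
   Context: For a $C^2$ function $u$, $D^2u=(u_{,ij})$ is its Hessian matrix, where commas denote partial differentiation. The $2$-Hessian operator is $S_2(D^2u):=\sum_{1\le i<j\le N}\lambda_i\lambda_j$, where $\lambda_1,\dots,\lambda_N$ are the eigenvalues of $D^2u$; equivalently $S_2(D^2u)=\tfrac12\big[(\Delta u)^2-\mathrm{tr}((D^2u)^2)\big]$. Set $S_2^{ij}(D^2u):=\partial S_2(D^2u)/\partial u_{,ij}=(\Delta u)\,\delta_{ij}-u_{,ij}$. A classical solution $u$ of the Dirichlet problem is called admissible if the matrix $\big(S_2^{ij}(D^2u)\big)$ is positive definite in $\Omega$ (ellipticity condition). *)

theory Defs
  imports "HOL-Analysis.Analysis"
begin

definition charpoly :: "real^'n^'n \<Rightarrow> real poly" where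
  "charpoly A = det (\<chi> i j. [:- (A$i$j), if i = j then 1 else 0:])"

lemma poly_charpoly: "poly (charpoly A) t = det (mat t - A)"
  unfolding charpoly_def det_def poly_sum
proof (rule sum.cong)
  fix p :: "'a \<Rightarrow> 'a"
  show "poly (of_int (sign p) * (\<Prod>i\<in>UNIV. (\<chi> i j. [:- (A$i$j), if i = j then 1 else 0:])$i$p i)) t =
        of_int (sign p) * (\<Prod>i\<in>UNIV. (mat t - A)$i$p i)"
    by (auto simp: poly_prod mat_def sign_def intro!: prod.cong)
qed simp

text \<open>The real eigenvalues, with algebraic multiplicity. For a symmetric matrix these are all
  \<open>CARD('n)\<close> eigenvalues, see \<open>size_eigenvalues_symmetric\<close> below.\<close>

definition eigenvalues :: "real^'n^'n \<Rightarrow> real multiset" where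
  "eigenvalues A = proots (charpoly A)"

definition S2 :: "real^'n^'n \<Rightarrow> real" where
  "S2 A = (let l = sorted_list_of_multiset (eigenvalues A) in
             \<Sum>j<length l. \<Sum>i<j. l!i * l!j)"

text \<open>For symmetric matrices, the derivative of \<open>S2\<close> with respect to the entries; see
  \<open>S2_has_derivative_S2_grad\<close> below.\<close>

definition S2_grad :: "real^'n^'n \<Rightarrow> real^'n^'n" where
  "S2_grad A = mat (trace A) - A"

definition pos_def :: "real^'n^'n \<Rightarrow> bool" where
  "pos_def A \<longleftrightarrow> (\<forall>v. v \<noteq> 0 \<longrightarrow> 0 < v \<bullet> (A *v v))"

lemma symmetric_eigenvector_in_subspace:
  fixes A :: "real^'n^'n" and V :: "(real^'n) set"
  assumes A: "transpose A = A" and V: "subspace V" and inv: "\<And>v. v \<in> V \<Longrightarrow> A *v v \<in> V"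
    and nz: "V \<noteq> {0}"
  obtains v l where "v \<in> V" "norm v = 1" "A *v v = l *\<^sub>R v"
proof -
  have symm: "x \<bullet> (A *v y) = y \<bullet> (A *v x)" for x y
    by (metis A dot_lmul_matrix inner_commute transpose_matrix_vector)
  define q where "q = (\<lambda>v. v \<bullet> (A *v v))"
  obtain w where w: "w \<in> V" "w \<noteq> 0" using nz V subspace_0 by blast
  have "w /\<^sub>R norm w \<in> V \<inter> sphere 0 1" using w V by (simp add: subspace_scale)
  then have ne: "V \<inter> sphere 0 1 \<noteq> {}" by blast
  have cpt: "compact (V \<inter> sphere 0 1)"
    using V by (metis closed_subspace compact_sphere closed_Int_compact)
  have "continuous_on (V \<inter> sphere 0 1) q"
    unfolding q_def by (intro continuous_intros)
  then obtain v where v: "v \<in> V" "norm v = 1" and mx: "\<And>y. y \<in> V \<inter> sphere 0 1 \<Longrightarrow> q y \<le> q v"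
    using continuous_attains_sup[OF cpt ne] by (metis IntE mem_sphere_0)
  have qle: "q y \<le> q v * (y \<bullet> y)" if "y \<in> V" for y
  proof (cases "y = 0")
    case True then show ?thesis by (simp add: q_def)
  next
    case False
    have "q (y /\<^sub>R norm y) \<le> q v" using that V False by (intro mx) (simp add: subspace_scale)
    moreover have "q (y /\<^sub>R norm y) = q y / (y \<bullet> y)"
      unfolding q_def using False
      by (simp add: matrix_vector_mult_scaleR field_simps dot_square_norm power2_eq_square)
    ultimately show ?thesis using False by (simp add: divide_le_eq)
  qed
  define z where "z = A *v v - q v *\<^sub>R v"
  have zV: "z \<in> V" unfolding z_def using v V inv by (simp add: subspace_diff subspace_scale)
  have vv: "v \<bullet> v = 1" using v by (simp add: dot_square_norm)
  have vz: "v \<bullet> z = 0" unfolding z_def by (simp add: inner_diff_right q_def vv)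
  have zAv: "z \<bullet> (A *v v) = z \<bullet> z"
    using vz by (simp add: z_def inner_diff_right inner_commute)
  define c where "c = q v * (z \<bullet> z) - q z"
  have key: "2 * t * (z \<bullet> z) \<le> t\<^sup>2 * c" for t :: real
  proof -
    have 1: "q (v + t *\<^sub>R z) \<le> q v * ((v + t *\<^sub>R z) \<bullet> (v + t *\<^sub>R z))"
      using v zV V by (intro qle) (simp add: subspace_add subspace_scale)
    have 2: "q (v + t *\<^sub>R z) = q v + 2 * t * (z \<bullet> z) + t\<^sup>2 * q z"
      using symm[of v z] zAv
      by (simp add: q_def matrix_vector_right_distrib matrix_vector_mult_scaleR inner_add_left
          inner_add_right power2_eq_square algebra_simps)
    have 3: "(v + t *\<^sub>R z) \<bullet> (v + t *\<^sub>R z) = 1 + t\<^sup>2 * (z \<bullet> z)"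
      using vv vz by (simp add: inner_add_left inner_add_right inner_commute power2_eq_square)
    have "2 * t * (z \<bullet> z) + t\<^sup>2 * q z \<le> q v * (t\<^sup>2 * (z \<bullet> z))"
      using 1 unfolding 2 3 by (simp add: distrib_left)
    then show ?thesis by (simp add: c_def right_diff_distrib mult.left_commute)
  qed
  have "z \<bullet> z = 0"
  proof (rule ccontr)
    assume "z \<bullet> z \<noteq> 0"
    then have pos: "z \<bullet> z > 0" by (simp add: less_le)
    show False
    proof (cases "c \<le> 0")
      case True
      then show False using key[of 1] pos by simp
    next
      case False
      define r where "r = ((z \<bullet> z) / c) * (z \<bullet> z)"
      have "2 * ((z \<bullet> z) / c) * (z \<bullet> z) \<le> ((z \<bullet> z) / c)\<^sup>2 * c" using key by blast
      moreover have "((z \<bullet> z) / c)\<^sup>2 * c = r" using False by (simp add: r_def power2_eq_square)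
      moreover have "2 * ((z \<bullet> z) / c) * (z \<bullet> z) = 2 * r" by (simp add: r_def)
      moreover have "r > 0" unfolding r_def using pos False by (intro mult_pos_pos divide_pos_pos) auto
      ultimately show False by linarith
    qed
  qed
  then have "A *v v = q v *\<^sub>R v" by (simp add: z_def)
  with v that show ?thesis by blast
qed

lemma symmetric_eigenbasis_subspace:
  fixes A :: "real^'n^'n" and V :: "(real^'n) set"
  assumes A: "transpose A = A"
  shows "subspace V \<Longrightarrow> (\<And>v. v \<in> V \<Longrightarrow> A *v v \<in> V) \<Longrightarrow>
    \<exists>B \<subseteq> V. pairwise orthogonal B \<and> (\<forall>b\<in>B. norm b = 1 \<and> (\<exists>l. A *v b = l *\<^sub>R b)) \<and> card B = dim V
      \<and> finite B"
proof (induction "dim V" arbitrary: V rule: less_induct)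
  case less
  show ?case
  proof (cases "V = {0}")
    case True
    then show ?thesis by (intro exI[of _ "{}"]) auto
  next
    case False
    obtain v l where v: "v \<in> V" "norm v = 1" "A *v v = l *\<^sub>R v"
      using symmetric_eigenvector_in_subspace[OF A less.prems(1) less.prems(2) False] by metis
    define W where "W = {w \<in> V. v \<bullet> w = 0}"
    have subW: "subspace W"
      using less.prems(1) unfolding W_def subspace_def by (auto simp: inner_add_right)
    have invW: "A *v w \<in> W" if "w \<in> W" for w
    proof -
      have "v \<bullet> (A *v w) = (A *v v) \<bullet> w"
        by (metis A dot_lmul_matrix transpose_matrix_vector)
      then show ?thesis using that less.prems(2) v by (simp add: W_def)
    qed
    have "dim W + dim {v} = dim V"
    proof -
      have "dim {y \<in> span V. \<forall>x \<in> span {v}. orthogonal x y} + dim (span {v}) = dim (span V)"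
        by (rule dim_subspace_orthogonal_to_vectors)
          (use v in \<open>auto simp: span_mono\<close>)
      moreover have "{y \<in> span V. \<forall>x \<in> span {v}. orthogonal x y} = W"
        using less.prems(1) by (auto simp: W_def span_eq_iff[THEN iffD2] orthogonal_def span_singleton)
      ultimately show ?thesis by simp
    qed
    moreover have "dim {v} = 1" using v by (subst dim_singleton) auto
    ultimately have dimW: "dim V = Suc (dim W)" by simp
    obtain B where B: "B \<subseteq> W" "pairwise orthogonal B"
        "\<forall>b\<in>B. norm b = 1 \<and> (\<exists>l. A *v b = l *\<^sub>R b)" "card B = dim W" "finite B"
      using less.hyps[OF _ subW invW] dimW by auto
    have "v \<notin> B" using B(1) v by (auto simp: W_def dot_square_norm)
    then have "card (insert v B) = dim V" using B dimW by simp
    moreover have "pairwise orthogonal (insert v B)"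
      using B by (auto simp: pairwise_insert orthogonal_def W_def inner_commute)
    moreover have "insert v B \<subseteq> V" using B v by (auto simp: W_def)
    ultimately show ?thesis using B v by (intro exI[of _ "insert v B"]) auto
  qed
qed

lemma symmetric_diagonalize:
  fixes A :: "real^'n^'n"
  assumes A: "transpose A = A"
  obtains P :: "real^'n^'n" and d :: "'n \<Rightarrow> real"
  where "orthogonal_matrix P" "A = P ** (\<chi> i j. if i = j then d i else 0) ** transpose P"
proof -
  obtain B where B: "pairwise orthogonal B"
      "\<forall>b\<in>B. norm b = 1 \<and> (\<exists>l. A *v b = l *\<^sub>R b)" "card B = CARD('n)" "finite B"
    using symmetric_eigenbasis_subspace[OF A subspace_UNIV] by (auto simp: dim_UNIV)
  obtain b where b: "bij_betw b (UNIV::'n set) B"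
    using B finite_same_card_bij[of "UNIV::'n set" B] by auto
  define d where "d i = (SOME l. A *v b i = l *\<^sub>R b i)" for i
  have bB: "b i \<in> B" for i using b by (auto simp: bij_betw_def)
  have d: "A *v b i = d i *\<^sub>R b i" for i
    unfolding d_def by (rule someI_ex) (use B bB in blast)
  define P :: "real^'n^'n" where "P = (\<chi> i j. b j $ i)"
  have on: "b i \<bullet> b j = (if i = j then 1 else 0)" for i j
  proof (cases "i = j")
    case True then show ?thesis using B bB[of j] by (auto simp: dot_square_norm)
  next
    case False
    then have "b i \<noteq> b j" using b by (auto simp: bij_betw_def inj_def)
    then show ?thesis using False B(1) bB by (auto simp: pairwise_def orthogonal_def)
  qed
  have PtP: "transpose P ** P = mat 1"
    using on by (auto simp: vec_eq_iff matrix_matrix_mult_def transpose_def P_def mat_def inner_vec_def)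
  then have orth: "orthogonal_matrix P" by (simp add: orthogonal_matrix)
  have AP: "A ** P = P ** (\<chi> i j. if i = j then d i else 0)"
  proof -
    have "(A ** P) $ i $ j = (P ** (\<chi> i j. if i = j then d i else 0)) $ i $ j" for i j
    proof -
      have "(A ** P) $ i $ j = (A *v b j) $ i"
        by (simp add: matrix_matrix_mult_def matrix_vector_mult_def P_def)
      also have "\<dots> = b j $ i * d j" by (simp add: d)
      also have "\<dots> = (\<Sum>k\<in>UNIV. if k = j then b k $ i * d k else 0)"
        by (subst sum.delta) auto
      also have "\<dots> = (P ** (\<chi> i j. if i = j then d i else 0)) $ i $ j"
        by (auto simp: matrix_matrix_mult_def P_def simp del: sum.delta intro!: sum.cong)
      finally show ?thesis .
    qed
    then show ?thesis by (simp add: vec_eq_iff)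
  qed
  have "A = A ** (P ** transpose P)" using orth by (simp add: orthogonal_matrix_def)
  also have "\<dots> = P ** (\<chi> i j. if i = j then d i else 0) ** transpose P"
    by (simp add: matrix_mul_assoc AP)
  finally show ?thesis using that orth by blast
qed

lemma eigenvalues_diagonalized:
  fixes P :: "real^'n^'n" and d :: "'n \<Rightarrow> real"
  assumes P: "orthogonal_matrix P"
    and A: "A = P ** (\<chi> i j. if i = j then d i else 0) ** transpose P"
  shows "eigenvalues A = image_mset d (mset_set UNIV)"
proof -
  have PPt: "P ** transpose P = mat 1" using P by (simp add: orthogonal_matrix_def)
  have scal: "mat t ** M = t *\<^sub>R M" "M ** mat t = t *\<^sub>R M" for t and M :: "real^'n^'n"
    by (auto simp: vec_eq_iff matrix_matrix_mult_def mat_def if_distrib if_distribR cong: if_cong)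
  have "poly (charpoly A) t = poly (\<Prod>i\<in>UNIV. [:- d i, 1:]) t" for t
  proof -
    let ?D = "(\<chi> i j. if i = j then d i else 0) :: real^'n^'n"
    have "P ** mat t ** transpose P = mat t ** (P ** transpose P)"
      by (simp only: scal matrix_mul_assoc)
    then have "P ** mat t ** transpose P = mat t" by (simp add: PPt)
    then have "P ** (mat t - ?D) ** transpose P = mat t - A"
      unfolding A
      by (simp add: matrix_eq matrix_vector_mult_diff_rdistrib matrix_vector_mult_diff_distrib
          flip: matrix_vector_mul_assoc)
    then have "det (mat t - A) = det (P ** (mat t - ?D) ** transpose P)" by simp
    also have "\<dots> = det (mat t - ?D) * (det P * det (transpose P))" by (simp add: det_mul)
    also have "det P * det (transpose P) = 1" by (metis PPt det_I det_mul)
    also have "det (mat t - ?D) = (\<Prod>i\<in>UNIV. t - d i)"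
      by (subst det_diagonal) (auto simp: mat_def)
    finally show ?thesis by (simp add: poly_charpoly poly_prod)
  qed
  then have "charpoly A = (\<Prod>i\<in>UNIV. [:- d i, 1:])" by (intro poly_ext)
  moreover have "(\<Sum>i\<in>S. {#d i#}) = image_mset d (mset_set S)" if "finite S" for S
    using that by induction auto
  ultimately show ?thesis by (simp add: eigenvalues_def proots_prod)
qed

lemma size_eigenvalues_symmetric:
  fixes A :: "real^'n^'n"
  assumes "transpose A = A"
  shows "size (eigenvalues A) = CARD('n)"
proof -
  obtain P d where "orthogonal_matrix P" "A = P ** (\<chi> i j. if i = j then d i else 0) ** transpose P"
    by (rule symmetric_diagonalize[OF assms])
  from eigenvalues_diagonalized[OF this] show ?thesis by simp
qed

lemma sum_pairs_list:
  fixes l :: "real list"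
  shows "(\<Sum>j<length l. \<Sum>i<j. l!i * l!j) = ((\<Sum>x\<leftarrow>l. x)\<^sup>2 - (\<Sum>x\<leftarrow>l. x\<^sup>2)) / 2"
proof (induction l rule: rev_induct)
  case (snoc x l)
  have "(\<Sum>i<length l. (l @ [x])!i * x) = (\<Sum>i<length l. l!i) * x"
    by (simp add: nth_append sum_distrib_right)
  also have "(\<Sum>i<length l. l!i) = sum_list l"
    by (metis atLeast0LessThan sum_list_sum_nth)
  finally have a: "(\<Sum>i<length l. (l @ [x])!i * x) = sum_list l * x" .
  have "(\<Sum>j<length l. \<Sum>i<j. (l @ [x])!i * (l @ [x])!j) = (\<Sum>j<length l. \<Sum>i<j. l!i * l!j)"
    by (intro sum.cong refl) (simp add: nth_append)
  then show ?case using snoc a by (simp add: power2_sum field_simps)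
qed simp

lemma S2_symmetric:
  fixes A :: "real^'n^'n"
  assumes "transpose A = A"
  shows "S2 A = ((trace A)\<^sup>2 - trace (A ** A)) / 2"
proof -
  obtain P d where P: "orthogonal_matrix P"
    and A: "A = P ** (\<chi> i j. if i = j then d i else 0) ** transpose P"
    by (rule symmetric_diagonalize[OF assms])
  let ?D = "(\<chi> i j. if i = j then d i else 0) :: real^'n^'n"
  have PtP: "transpose P ** P = mat 1" using P by (simp add: orthogonal_matrix_def)
  define l where "l = sorted_list_of_multiset (eigenvalues A)"
  have ml: "mset l = image_mset d (mset_set UNIV)"
    using eigenvalues_diagonalized[OF P A] by (simp add: l_def)
  have s: "(\<Sum>x\<leftarrow>l. g x) = (\<Sum>i\<in>UNIV. g (d i))" for g :: "real \<Rightarrow> real"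
  proof -
    have "(\<Sum>x\<leftarrow>l. g x) = sum_mset (image_mset g (mset l))"
      by (metis mset_map sum_mset_sum_list)
    then show ?thesis unfolding ml by (simp add: sum_unfold_sum_mset multiset.map_comp comp_def)
  qed
  have t1: "trace A = (\<Sum>i\<in>UNIV. d i)"
  proof -
    have "trace A = trace (transpose P ** (P ** ?D))" unfolding A by (rule trace_mul_sym)
    also have "\<dots> = trace ?D" by (simp add: matrix_mul_assoc PtP)
    finally show ?thesis by (simp add: trace_def)
  qed
  have t2: "trace (A ** A) = (\<Sum>i\<in>UNIV. (d i)\<^sup>2)"
  proof -
    have "A ** A = P ** ?D ** (transpose P ** P) ** ?D ** transpose P"
      unfolding A by (simp only: matrix_mul_assoc)
    also have "\<dots> = P ** (?D ** ?D ** transpose P)"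
      by (simp only: PtP matrix_mul_rid) (simp only: matrix_mul_assoc)
    finally have "trace (A ** A) = trace ((?D ** ?D ** transpose P) ** P)"
      by (simp only: trace_mul_sym[of P])
    also have "\<dots> = trace (?D ** ?D)"
      by (simp only: matrix_mul_assoc[symmetric] PtP matrix_mul_rid)
    also have "\<dots> = (\<Sum>i\<in>UNIV. (d i)\<^sup>2)"
    proof -
      have "(?D ** ?D) $ i $ i = (\<Sum>k\<in>UNIV. if k = i then (d i)\<^sup>2 else 0)" for i
        unfolding matrix_matrix_mult_def
        by (simp del: sum.delta) (intro sum.cong, auto simp: power2_eq_square)
      then show ?thesis by (simp add: trace_def)
    qed
    finally show ?thesis .
  qed
  have "S2 A = (\<Sum>j<length l. \<Sum>i<j. l!i * l!j)"
    by (simp add: S2_def l_def Let_def)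
  then show ?thesis
    unfolding sum_pairs_list using s[of "\<lambda>x. x"] s[of "\<lambda>x. x\<^sup>2"] t1 t2 by simp
qed

lemma S2_has_derivative_S2_grad:
  fixes A H :: "real^'n^'n"
  assumes A: "transpose A = A" and H: "transpose H = H"
  shows "((\<lambda>t. S2 (A + t *\<^sub>R H)) has_real_derivative (\<Sum>i\<in>UNIV. \<Sum>j\<in>UNIV. S2_grad A $ i $ j * H $ i $ j)) (at 0)"
proof -
  have symm: "transpose (A + t *\<^sub>R H) = A + t *\<^sub>R H" for t
    using A H by (simp add: vec_eq_iff transpose_def)
  have Hs: "H $ i $ j = H $ j $ i" for i j using H by (metis transpose_def vec_lambda_beta)
  have e: "S2 (A + t *\<^sub>R H) = ((\<Sum>i\<in>UNIV. A$i$i + t * H$i$i)\<^sup>2 -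
      (\<Sum>i\<in>UNIV. \<Sum>j\<in>UNIV. (A$i$j + t * H$i$j) * (A$j$i + t * H$j$i))) / 2" for t
    unfolding S2_symmetric[OF symm] by (simp add: trace_def matrix_matrix_mult_def)
  have c: "(\<Sum>i\<in>UNIV. \<Sum>j\<in>UNIV. A$j$i * H$i$j) = (\<Sum>i\<in>UNIV. \<Sum>j\<in>UNIV. A$i$j * H$i$j)"
    by (subst sum.swap) (simp add: Hs)
  have g: "(\<Sum>i\<in>UNIV. \<Sum>j\<in>UNIV. S2_grad A $ i $ j * H $ i $ j)
      = (\<Sum>i\<in>UNIV. A$i$i) * (\<Sum>i\<in>UNIV. H$i$i) - (\<Sum>i\<in>UNIV. \<Sum>j\<in>UNIV. A$i$j * H$i$j)"
  proof -
    have "S2_grad A $ i $ j * H $ i $ j = (if j = i then trace A * H $ i $ i else 0) - A$i$j * H$i$j" for i j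
      by (simp add: S2_grad_def mat_def left_diff_distrib)
    then show ?thesis by (simp add: sum_subtractf trace_def sum_distrib_left)
  qed
  have c': "(\<Sum>i\<in>UNIV. \<Sum>j\<in>UNIV. H$i$j * A$j$i + H$j$i * A$i$j) = 2 * (\<Sum>i\<in>UNIV. \<Sum>j\<in>UNIV. A$i$j * H$i$j)"
    using c Hs by (simp add: sum.distrib mult.commute)
  show ?thesis
    unfolding e g
    by (rule derivative_eq_intros refl)+
      (simp, simp add: diff_divide_distrib, use c' in \<open>simp only: mult.commute\<close>)
qed

definition partial_deriv :: "'n \<Rightarrow> (real^'n \<Rightarrow> real) \<Rightarrow> real^'n \<Rightarrow> real" where
  "partial_deriv i g x = frechet_derivative g (at x) (axis i 1)"

definition hessian :: "(real^'n \<Rightarrow> real) \<Rightarrow> real^'n \<Rightarrow> real^'n^'n" where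
  "hessian g x = (\<chi> i j. partial_deriv j (partial_deriv i g) x)"

primrec Ck_on :: "nat \<Rightarrow> (real^'n \<Rightarrow> real) \<Rightarrow> (real^'n) set \<Rightarrow> bool" where
  "Ck_on 0 g S \<longleftrightarrow> continuous_on S g"
| "Ck_on (Suc k) g S \<longleftrightarrow> (\<forall>x\<in>S. g differentiable (at x)) \<and> (\<forall>i. Ck_on k (partial_deriv i g) S)"

text \<open>\<open>g\<close> and all its partial derivatives of order at most \<open>k\<close> in the open set \<open>S\<close> extend
  continuously to the closure of \<open>S\<close>.\<close>

primrec Ck_extends :: "nat \<Rightarrow> (real^'n \<Rightarrow> real) \<Rightarrow> (real^'n) set \<Rightarrow> bool" where
  "Ck_extends 0 g S \<longleftrightarrow> (\<exists>h. continuous_on (closure S) h \<and> (\<forall>x\<in>S. h x = g x))"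
| "Ck_extends (Suc k) g S \<longleftrightarrow> (\<exists>h. continuous_on (closure S) h \<and> (\<forall>x\<in>S. h x = g x)) \<and>
     (\<forall>x\<in>S. g differentiable (at x)) \<and> (\<forall>i. Ck_extends k (partial_deriv i g) S)"

definition Ck_closure :: "nat \<Rightarrow> (real^'n \<Rightarrow> real) \<Rightarrow> (real^'n) set \<Rightarrow> bool" where
  "Ck_closure k g S \<longleftrightarrow> continuous_on (closure S) g \<and> Ck_extends k g S"

text \<open>The gradient of a \<open>C\<^sup>1\<close> function on the closure of the open set \<open>S\<close>: in \<open>S\<close> it is the usual
  one, on the boundary it is the continuous extension from \<open>S\<close> (the values of \<open>g\<close> outside the
  closure are irrelevant).\<close>

definition grad_closure :: "(real^'n) set \<Rightarrow> (real^'n \<Rightarrow> real) \<Rightarrow> real^'n \<Rightarrow> real^'n" where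
  "grad_closure S g x = (\<chi> i. Lim (at x within S) (partial_deriv i g))"

lemma grad_closure_extension:
  fixes S :: "(real^'n) set"
  assumes S: "open S" and x: "x \<in> closure S"
    and h: "continuous_on (closure S) h" "\<And>y. y \<in> S \<Longrightarrow> h y = partial_deriv i g y"
  shows "grad_closure S g x $ i = h x"
proof -
  have nt: "at x within S \<noteq> bot"
  proof (cases "x \<in> S")
    case True then show ?thesis using S by (metis at_neq_bot at_within_open)
  next
    case False
    with x have "x islimpt S" by (auto simp: closure_def)
    then show ?thesis by (simp add: trivial_limit_within)
  qed
  have "(h \<longlongrightarrow> h x) (at x within S)"
    by (rule tendsto_within_subset[OF _ closure_subset]) (use h(1) x in \<open>simp add: continuous_on_def\<close>)
  then have "(partial_deriv i g \<longlongrightarrow> h x) (at x within S)"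
    by (rule Lim_transform_eventually) (simp add: eventually_at_filter h(2))
  then show ?thesis using nt by (simp add: grad_closure_def tendsto_Lim)
qed

lemma grad_closure_interior:
  fixes S :: "(real^'n) set"
  assumes "open S" "x \<in> S" "Ck_on 1 g S"
  shows "grad_closure S g x = (\<chi> i. partial_deriv i g x)"
proof -
  have "Lim (at x within S) (partial_deriv i g) = partial_deriv i g x" for i
  proof -
    have "isCont (partial_deriv i g) x"
      using assms by (auto simp: continuous_on_eq_continuous_at)
    then show ?thesis
      unfolding at_within_open[OF assms(2,1)] isCont_def by (rule tendsto_Lim[OF at_neq_bot])
  qed
  then show ?thesis by (simp add: grad_closure_def)
qed

text \<open>The integral is oriented: it changes sign when \<open>u x > 0\<close>.\<close>

definition Phi :: "real \<Rightarrow> (real \<Rightarrow> real) \<Rightarrow> (real^'n \<Rightarrow> real) \<Rightarrow> (real^'n) set \<Rightarrow> real^'n \<Rightarrow> real" where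
  "Phi \<alpha> f u \<Omega> x = (norm (grad_closure \<Omega> u x))\<^sup>2 + 2 * \<alpha> * (LBINT s = ereal (u x)..ereal 0. sqrt (f s))"

end

theory Submission
  imports Defs
begin

text \<open>Let \<open>\<beta> > 1\<close>. At an interior minimum of the P-function \<open>\<Phi>(\<cdot>, \<beta>)\<close> the gradient of \<open>u\<close> is
  an eigenvector of \<open>A = D\<^sup>2u\<close> with eigenvalue \<open>m = \<beta> \<surd>f\<close> (or zero), and since \<open>U \<circ> u\<close> is convex, \<open>A\<close> is
  nonnegative on the orthogonal complement of the gradient; so all eigenvalues \<open>d\<^sub>i\<close> of \<open>A\<close> are
  nonnegative. If the gradient vanishes, the second-order condition forces every positive \<open>d\<^sub>i\<close> to be at
  least \<open>m\<close>, whence \<open>S2 A \<ge> m\<^sup>2 > f\<close>. Otherwise, contracting the Hessian of \<open>\<Phi>\<close> with the admissible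
  matrix \<open>S2_grad A\<close> and differentiating the equation once gives, with \<open>T = trace A\<close>,
  \<open>\<Sum>\<^sub>i (T - d\<^sub>i) d\<^sub>i (d\<^sub>i - m) + f' \<bar>\<nabla>u\<bar>\<^sup>2 (1 - \<beta> (T - m) / (2 \<surd>f)) \<ge> 0\<close>, which is impossible because
  \<open>T - m \<le> \<surd>f / \<beta> < m\<close>. So the minimum lies on the boundary, where \<open>\<Phi>\<close> does not depend on \<open>\<beta>\<close>,
  and \<open>\<alpha> = 1\<close> follows in the limit.\<close>

section \<open>Second-derivative test in one variable\<close>

text \<open>Near 0 the sign of \<open>g'\<close> is fixed by \<open>c\<close>: positive on the left,
  negative on the right; the mean value theorem carries this over to \<open>g\<close>. The test is
  applied along lines, to the P-function at its minimum and to \<open>u\<close> in directions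
  orthogonal to its gradient.\<close>

lemma second_derivative_neg_imp_strict_local_max:
  fixes g g' :: "real \<Rightarrow> real"
  assumes r: "0 < r" and g: "\<And>t. \<bar>t\<bar> < r \<Longrightarrow> (g has_real_derivative g' t) (at t)"
    and g0: "g' 0 = 0" and g': "(g' has_real_derivative c) (at 0)" and c: "c < 0"
  obtains \<delta> where "0 < \<delta>" "\<And>t. t \<noteq> 0 \<Longrightarrow> \<bar>t\<bar> < \<delta> \<Longrightarrow> g t < g 0"
proof -
  obtain d1 where d1: "0 < d1" "\<And>h. 0 < h \<Longrightarrow> h < d1 \<Longrightarrow> g' h < 0"
    using DERIV_neg_dec_right[OF g' c] g0 by auto
  obtain d2 where d2: "0 < d2" "\<And>h. 0 < h \<Longrightarrow> h < d2 \<Longrightarrow> 0 < g' (- h)"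
    using DERIV_neg_dec_left[OF g' c] g0 by auto
  define \<delta> where "\<delta> = min r (min d1 d2)"
  have "g t < g 0" if "t \<noteq> 0" "\<bar>t\<bar> < \<delta>" for t
  proof (cases "0 < t")
    case True
    have "\<exists>z>0. z < t \<and> g t - g 0 = (t - 0) * g' z"
      using that True by (intro MVT2 g) (auto simp: \<delta>_def)
    then obtain z where z: "0 < z" "z < t" "g t - g 0 = t * g' z" by auto
    then have "g' z < 0" using d1(2)[of z] that True by (auto simp: \<delta>_def)
    then have "t * g' z < 0" using True by (rule mult_pos_neg[rotated])
    then show ?thesis using z by simp
  next
    case False
    then have t: "t < 0" using that by simp
    have "\<exists>z>t. z < 0 \<and> g 0 - g t = (0 - t) * g' z"
      using that t by (intro MVT2 g) (auto simp: \<delta>_def)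
    then obtain z where z: "t < z" "z < 0" "g 0 - g t = (0 - t) * g' z" by auto
    then have "0 < g' z" using d2(2)[of "- z"] that t by (auto simp: \<delta>_def)
    then have "0 < (0 - t) * g' z" using t by (intro mult_pos_pos) auto
    then show ?thesis using z by simp
  qed
  then show ?thesis using that[of \<delta>] r d1 d2 by (auto simp: \<delta>_def)
qed

section \<open>Gradients, derivatives along lines, symmetry of second derivatives\<close>

definition gradient :: "(real^'n \<Rightarrow> real) \<Rightarrow> real^'n \<Rightarrow> real^'n" where
  "gradient g x = (\<chi> i. partial_deriv i g x)"

lemma has_derivative_gradient:
  fixes g :: "real^'n \<Rightarrow> real"
  assumes "g differentiable (at x)"
  shows "(g has_derivative (\<lambda>h. gradient g x \<bullet> h)) (at x)"
proof -
  interpret linear "frechet_derivative g (at x)" by (rule linear_frechet_derivative[OF assms])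
  have "frechet_derivative g (at x) h = gradient g x \<bullet> h" for h
  proof -
    have "frechet_derivative g (at x) h = frechet_derivative g (at x) (\<Sum>i\<in>UNIV. h $ i *\<^sub>R axis i 1)"
      by (simp add: basis_expansion[of h, simplified scalar_mult_eq_scaleR])
    also have "\<dots> = gradient g x \<bullet> h"
      by (simp add: sum scale gradient_def partial_deriv_def inner_vec_def mult.commute)
    finally show ?thesis .
  qed
  then have "frechet_derivative g (at x) = (\<lambda>h. gradient g x \<bullet> h)" ..
  then show ?thesis using assms by (simp add: frechet_derivative_works)
qed

lemma has_real_derivative_along_line:
  fixes g :: "real^'n \<Rightarrow> real"
  assumes "g differentiable (at (x + t *\<^sub>R p))"
  shows "((\<lambda>t. g (x + t *\<^sub>R p)) has_real_derivative gradient g (x + t *\<^sub>R p) \<bullet> p) (at t)"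
proof -
  have "((\<lambda>t. x + t *\<^sub>R p) has_derivative (\<lambda>h. h *\<^sub>R p)) (at t)"
    by (auto intro!: derivative_eq_intros)
  from has_derivative_compose[OF this has_derivative_gradient[OF assms]]
  show ?thesis by (simp add: has_field_derivative_def mult_commute_abs)
qed

text \<open>The second difference is symmetric in \<open>i\<close> and \<open>j\<close>, so this yields Schwarz's theorem.\<close>

lemma second_difference_approx:
  fixes g :: "real^'n \<Rightarrow> real"
  assumes S: "open S" "x \<in> S" and g: "\<And>y. y \<in> S \<Longrightarrow> g differentiable (at y)"
    and g2: "partial_deriv i g differentiable (at x)" and e: "0 < e"
  shows "\<exists>\<delta>>0. \<forall>t. 0 < t \<and> t < \<delta> \<longrightarrow>
    \<bar>g (x + t *\<^sub>R axis i 1 + t *\<^sub>R axis j 1) - g (x + t *\<^sub>R axis i 1) - g (x + t *\<^sub>R axis j 1) + g x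
      - t\<^sup>2 * partial_deriv j (partial_deriv i g) x\<bar> \<le> e * t\<^sup>2"
proof -
  define a b :: "real^'n" where "a = axis i 1" and "b = axis j 1"
  have ab: "norm a = 1" "norm b = 1" by (simp_all add: a_def b_def)
  define L where "L h = gradient (partial_deriv i g) x \<bullet> h" for h
  have L: "(partial_deriv i g has_derivative L) (at x)"
    unfolding L_def using has_derivative_gradient[OF g2] by simp
  have Lb: "L b = partial_deriv j (partial_deriv i g) x"
    by (simp add: L_def b_def inner_axis gradient_def)
  have ga: "gradient g y \<bullet> a = partial_deriv i g y" for y
    by (simp add: a_def inner_axis gradient_def)
  obtain \<delta>1 where \<delta>1: "0 < \<delta>1" and approx: "\<And>y. norm (y - x) < \<delta>1 \<Longrightarrow>
      norm (partial_deriv i g y - partial_deriv i g x - L (y - x)) \<le> e / 3 * norm (y - x)"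
    using L e unfolding has_derivative_at_alt by (meson divide_pos_pos zero_less_numeral)
  obtain \<delta>2 where \<delta>2: "0 < \<delta>2" "ball x \<delta>2 \<subseteq> S" using S openE by blast
  \<comment> \<open>The farthest points evaluated below lie within \<open>2 * t\<close> of
    \<open>x\<close>, hence the factor 1/2.\<close>
  define \<delta> where "\<delta> = min \<delta>1 \<delta>2 / 2"
  have "\<bar>g (x + t *\<^sub>R a + t *\<^sub>R b) - g (x + t *\<^sub>R a) - g (x + t *\<^sub>R b) + g x - t\<^sup>2 * L b\<bar> \<le> e * t\<^sup>2"
    if t: "0 < t" "t < \<delta>" for t
  proof -
    have n1: "norm (s *\<^sub>R a) \<le> t" "norm (s *\<^sub>R a + t *\<^sub>R b) \<le> 2 * t" if "0 \<le> s" "s \<le> t" for s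
      using norm_triangle_ineq[of "s *\<^sub>R a" "t *\<^sub>R b"] that t ab by auto
    have inS: "x + s *\<^sub>R a \<in> S" "x + t *\<^sub>R b + s *\<^sub>R a \<in> S" if "0 \<le> s" "s \<le> t" for s
      using n1[OF that] t \<delta>2(2) by (auto simp: \<delta>_def dist_norm add.assoc add.commute[of "t *\<^sub>R b"]
          norm_minus_commute intro!: subsetD[OF \<delta>2(2)])
    \<comment> \<open>The second difference is \<open>F t - F 0\<close>, so the mean value theorem
      in direction \<open>i\<close> replaces it by a first difference of
      \<open>partial_deriv i g\<close>. Its linear approximation at \<open>x\<close> is then used at
      two points, at distances at most \<open>2 * t\<close> and \<open>t\<close>; with tolerance
      \<open>e / 3\<close> the errors \<open>E1\<close> and \<open>E2\<close> add up to at most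
      \<open>e * t\<close>.\<close>
    define F where "F s = g (x + t *\<^sub>R b + s *\<^sub>R a) - g (x + s *\<^sub>R a)" for s
    define F' where "F' s = partial_deriv i g (x + t *\<^sub>R b + s *\<^sub>R a) - partial_deriv i g (x + s *\<^sub>R a)" for s
    have "(F has_real_derivative F' s) (at s)" if "0 \<le> s" "s \<le> t" for s
      unfolding F_def F'_def ga[symmetric]
      by (intro DERIV_diff has_real_derivative_along_line g inS that)
    then obtain z where z: "0 < z" "z < t" "F t - F 0 = t * F' z"
      using MVT2[OF t(1), of F F'] by auto
    define E1 where "E1 = partial_deriv i g (x + t *\<^sub>R b + z *\<^sub>R a) - partial_deriv i g x - L (t *\<^sub>R b + z *\<^sub>R a)"
    define E2 where "E2 = partial_deriv i g (x + z *\<^sub>R a) - partial_deriv i g x - L (z *\<^sub>R a)"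
    have "\<bar>E1\<bar> \<le> e / 3 * norm (t *\<^sub>R b + z *\<^sub>R a)"
      using approx[of "x + t *\<^sub>R b + z *\<^sub>R a"] n1[of z] z t
      by (auto simp: E1_def \<delta>_def add.assoc add.commute[of "t *\<^sub>R b"])
    also have "\<dots> \<le> e / 3 * (2 * t)"
      using n1[of z] z e by (intro mult_left_mono) (auto simp: add.commute)
    finally have E1: "\<bar>E1\<bar> \<le> 2 * (e * t) / 3" by simp
    have "\<bar>E2\<bar> \<le> e / 3 * norm (z *\<^sub>R a)"
      using approx[of "x + z *\<^sub>R a"] n1[of z] z t by (auto simp: E2_def \<delta>_def)
    also have "\<dots> \<le> e / 3 * t"
      using n1[of z] z e by (intro mult_left_mono) auto
    finally have E2: "\<bar>E2\<bar> \<le> e * t / 3" by simp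
    have F'z: "F' z = t * L b + E1 - E2"
      by (simp add: F'_def E1_def E2_def L_def inner_add_right)
    then have "F t - F 0 - t\<^sup>2 * L b = t * (E1 - E2)"
      unfolding z(3) F'z by (simp add: power2_eq_square algebra_simps)
    moreover have "\<bar>t * (E1 - E2)\<bar> \<le> t * (e * t)"
      unfolding abs_mult using E1 E2 t by (intro mult_mono) auto
    ultimately show ?thesis
      by (simp add: F_def power2_eq_square algebra_simps)
  qed
  then show ?thesis unfolding Lb[symmetric] using \<delta>1 \<delta>2
    by (intro exI[of _ \<delta>]) (auto simp: \<delta>_def a_def b_def)
qed

text \<open>Young's form of the theorem: the first partial derivatives are assumed differentiable at
  the point. One second difference has both mixed derivatives as its leading coefficient, so they
  differ by at most any positive \<open>e\<close>.\<close>

lemma partial_deriv_commute: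
  fixes g :: "real^'n \<Rightarrow> real"
  assumes S: "open S" "x \<in> S" and g: "\<And>y. y \<in> S \<Longrightarrow> g differentiable (at y)"
    and g2: "\<And>i. partial_deriv i g differentiable (at x)"
  shows "partial_deriv j (partial_deriv i g) x = partial_deriv i (partial_deriv j g) x"
proof -
  define l r where "l = partial_deriv j (partial_deriv i g) x" and "r = partial_deriv i (partial_deriv j g) x"
  have "\<bar>l - r\<bar> \<le> 0 + e" if e: "0 < e" for e
  proof -
    have e2: "0 < e / 2" using e by simp
    define D where "D t = g (x + t *\<^sub>R axis i 1 + t *\<^sub>R axis j 1) - g (x + t *\<^sub>R axis i 1)
      - g (x + t *\<^sub>R axis j 1) + g x" for t
    obtain d1 where d1: "d1 > 0" "\<And>t. 0 < t \<Longrightarrow> t < d1 \<Longrightarrow> \<bar>D t - t\<^sup>2 * l\<bar> \<le> e / 2 * t\<^sup>2"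
      using second_difference_approx[OF S g g2 e2, of i j] unfolding D_def l_def by blast
    have D': "D t = g (x + t *\<^sub>R axis j 1 + t *\<^sub>R axis i 1) - g (x + t *\<^sub>R axis j 1)
      - g (x + t *\<^sub>R axis i 1) + g x" for t
      unfolding D_def by (simp add: algebra_simps)
    obtain d2 where d2: "d2 > 0" "\<And>t. 0 < t \<Longrightarrow> t < d2 \<Longrightarrow> \<bar>D t - t\<^sup>2 * r\<bar> \<le> e / 2 * t\<^sup>2"
      using second_difference_approx[OF S g g2 e2, of j i] unfolding D' r_def by blast
    define t where "t = min d1 d2 / 2"
    have t: "0 < t" "t < d1" "t < d2" using d1(1) d2(1) by (auto simp: t_def)
    have "\<bar>t\<^sup>2 * l - t\<^sup>2 * r\<bar> \<le> e * t\<^sup>2" using d1(2)[OF t(1,2)] d2(2)[OF t(1,3)] by linarith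
    then have "t\<^sup>2 * \<bar>l - r\<bar> \<le> t\<^sup>2 * e"
      unfolding right_diff_distrib[symmetric] abs_mult by (simp add: mult.commute)
    then show ?thesis using t by simp
  qed
  then have "\<bar>l - r\<bar> \<le> 0" by (rule field_le_epsilon)
  then show ?thesis by (simp add: l_def r_def)
qed

section \<open>Eigenvalue inequalities at an interior minimum\<close>

text \<open>The purely algebraic core, in coordinates of an eigenbasis of the Hessian of
  \<open>u\<close>: \<open>d\<close> are the eigenvalues, \<open>w\<close> the components of the
  gradient, \<open>r i\<close> the third-order term in direction \<open>i\<close>, \<open>g\<close>
  the root of \<open>f\<close> and \<open>F\<close> the value of \<open>f'\<close>. Then
  \<open>dw\<close> is the first-order condition, \<open>ge0\<close> half the second derivative of
  the P-function in direction \<open>i\<close>, and \<open>r_sum\<close> the differentiated equation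
  contracted with the gradient.\<close>

lemma eigenvalue_inequalities_contradiction:
  fixes d w r :: "'n::finite \<Rightarrow> real"
  assumes d: "\<And>i. 0 \<le> d i" and Td: "\<And>i. 0 < T - d i" and T: "T = (\<Sum>i\<in>UNIV. d i)"
    and S2: "(\<Sum>i\<in>UNIV. (T - d i) * d i) = 2 * g\<^sup>2" and g: "0 < g" and \<beta>: "1 < \<beta>" and m: "m = \<beta> * g"
    and dw: "\<And>i. d i * w i = m * w i" and F: "F \<le> 0"
    and r_sum: "(\<Sum>i\<in>UNIV. (T - d i) * r i) = F * (\<Sum>i\<in>UNIV. (w i)\<^sup>2)"
    and r_crit: "\<And>i. (\<And>j. w j = 0) \<Longrightarrow> r i = 0"
    and ge0: "\<And>i. 0 \<le> (d i)\<^sup>2 + r i - \<beta> * (F / (2 * g)) * (w i)\<^sup>2 - m * d i"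
  shows False
proof -
  have m0: "0 < m" "g < m" using g \<beta> m by auto
  have sum_other: "(\<Sum>j\<in>UNIV - {i}. d j) = T - d i" for i
    unfolding T by (simp add: sum_diff1)
  \<comment> \<open>Ellipticity forces at least two positive eigenvalues: the sum of all but any one
    of them is positive.\<close>
  have ex_other: "\<exists>j. j \<noteq> i \<and> 0 < d j" for i
  proof (rule ccontr)
    assume "\<not> (\<exists>j. j \<noteq> i \<and> 0 < d j)"
    then have "(\<Sum>j\<in>UNIV - {i}. d j) \<le> 0" by (intro sum_nonpos) force
    then show False using sum_other[of i] Td[of i] by simp
  qed
  have le_other: "d j \<le> T - d i" if "j \<noteq> i" for i j
    unfolding sum_other[symmetric] using that d by (intro member_le_sum) auto
  show False
  proof (cases "\<forall>i. w i = 0")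
    case True
    \<comment> \<open>At a critical point of \<open>u\<close>, \<open>ge0\<close> reduces to
      \<open>d i * (d i - m)\<close> being nonnegative.\<close>
    have big: "m \<le> d i" if "0 < d i" for i
      using ge0[of i] r_crit[of i] True that by (auto simp: power2_eq_square)
    obtain i j where ij: "j \<noteq> i" "0 < d i" "0 < d j" using ex_other by metis
    have "2 * m\<^sup>2 \<le> 2 * (d i * d j)"
      using big[OF ij(2)] big[OF ij(3)] m0 by (auto simp: power2_eq_square intro!: mult_mono)
    also have "\<dots> \<le> (T - d i) * d i + (T - d j) * d j"
      using mult_right_mono[OF le_other[OF ij(1)] d[of i]] mult_right_mono[OF le_other[OF ij(1)[symmetric]] d[of j]]
      by (simp only: mult.commute)
    also have "\<dots> = (\<Sum>k\<in>{i, j}. (T - d k) * d k)" using ij by simp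
    also have "\<dots> \<le> (\<Sum>k\<in>UNIV. (T - d k) * d k)"
      by (intro sum_mono2) (use Td d in \<open>auto intro!: mult_nonneg_nonneg intro: less_imp_le\<close>)
    finally have "m\<^sup>2 \<le> g\<^sup>2" using S2 by simp
    then show False using m0 g by (simp add: power2_le_iff_abs_le)
  next
    case False
    then obtain k where k: "w k \<noteq> 0" by blast
    then have dk: "d k = m" using dw[of k] by simp
    \<comment> \<open>\<open>\<sigma>\<close> is the sum of the eigenvalues other than
      \<open>d k\<close>, which equals \<open>m\<close>. In \<open>2 * g\<^sup>2\<close>, the term
      of index \<open>k\<close> is \<open>m * \<sigma>\<close>; the other terms sum to at least
      \<open>m * \<sigma>\<close>, since \<open>T - d i\<close> contains the summand
      \<open>d k\<close> for \<open>i\<close> different from \<open>k\<close>.\<close>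
    define \<sigma> where "\<sigma> = T - m"
    have "2 * (m * \<sigma>) = (T - d k) * d k + (\<Sum>i\<in>UNIV - {k}. m * d i)"
      using sum_other[of k] dk by (simp add: \<sigma>_def flip: sum_distrib_left)
    also have "\<dots> \<le> (T - d k) * d k + (\<Sum>i\<in>UNIV - {k}. (T - d i) * d i)"
      using le_other[of k] dk d by (intro add_left_mono sum_mono mult_right_mono) auto
    also have "\<dots> = 2 * g\<^sup>2" unfolding S2[symmetric] by (simp add: sum.remove[of UNIV k])
    finally have m\<sigma>: "m * \<sigma> \<le> g\<^sup>2" by simp
    then have \<beta>\<sigma>: "\<beta> * \<sigma> \<le> g" using g by (simp add: m power2_eq_square)
    have \<sigma>0: "0 < \<sigma>" using Td[of k] dk by (simp add: \<sigma>_def)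
    have "\<sigma> \<le> \<beta> * \<sigma>" using \<beta> \<sigma>0 by simp
    then have \<sigma>m: "\<sigma> < m" using \<beta>\<sigma> m0 by linarith
    have term_le: "(T - d i) * (d i * (d i - m)) \<le> 0" for i
    proof (cases "i = k")
      case False
      then have "d i - m \<le> 0" using le_other[of i k] dk \<sigma>m by (simp add: \<sigma>_def)
      then show ?thesis using Td[of i] d[of i] by (simp add: mult_nonneg_nonpos)
    qed (simp add: dk)
    \<comment> \<open>A second positive eigenvalue is smaller than \<open>m\<close>, which makes the
      sum strictly negative.\<close>
    obtain j where j: "j \<noteq> k" "0 < d j" using ex_other by metis
    have "d j - m < 0" using le_other[of j k] j dk \<sigma>m by (simp add: \<sigma>_def)
    then have "(T - d j) * (d j * (d j - m)) < 0" using Td[of j] j by (simp add: mult_pos_neg)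
    then have X: "(\<Sum>i\<in>UNIV. (T - d i) * (d i * (d i - m))) < 0"
      using term_le sum_strict_mono_ex1[of UNIV "\<lambda>i. (T - d i) * (d i * (d i - m))" "\<lambda>i. 0"] by auto
    define q where "q = (\<Sum>i\<in>UNIV. (w i)\<^sup>2)"
    \<comment> \<open>The gradient has components only in the eigenspace of \<open>m\<close>, where
      the weight \<open>T - d i\<close> equals \<open>\<sigma>\<close>.\<close>
    have Tw: "(T - d i) * (w i)\<^sup>2 = \<sigma> * (w i)\<^sup>2" for i
      using dw[of i] by (cases "w i = 0") (auto simp: \<sigma>_def)
    \<comment> \<open>The positive weights \<open>T - d i\<close> are the eigenvalues of the
      linearised operator; with them the third-order terms combine into
      \<open>r_sum\<close>.\<close>
    have "0 \<le> (\<Sum>i\<in>UNIV. (T - d i) * ((d i)\<^sup>2 + r i - \<beta> * (F / (2 * g)) * (w i)\<^sup>2 - m * d i))"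
      using ge0 Td by (intro sum_nonneg mult_nonneg_nonneg) (auto intro: less_imp_le)
    also have "\<dots> = (\<Sum>i\<in>UNIV. (T - d i) * (d i * (d i - m)) + (T - d i) * r i
        - \<beta> * (F / (2 * g)) * ((T - d i) * (w i)\<^sup>2))"
    proof -
      have "s * (e\<^sup>2 + y - c * z - m * e) = s * (e * (e - m)) + s * y - c * (s * z)" for s e y c z :: real
        by (simp add: algebra_simps power2_eq_square)
      then show ?thesis by (simp only:)
    qed
    also have "\<dots> = (\<Sum>i\<in>UNIV. (T - d i) * (d i * (d i - m))) + F * q - \<beta> * (F / (2 * g)) * (\<sigma> * q)"
      by (simp only: Tw sum.distrib sum_subtractf r_sum q_def flip: sum_distrib_left)
    also have "\<dots> = (\<Sum>i\<in>UNIV. (T - d i) * (d i * (d i - m))) + (F * q) * (1 - \<beta> * \<sigma> / (2 * g))"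
      by (simp add: algebra_simps)
    finally have pos: "0 < (F * q) * (1 - \<beta> * \<sigma> / (2 * g))" using X by linarith
    have "F * q \<le> 0" using F by (intro mult_nonpos_nonneg) (auto simp: q_def sum_nonneg)
    moreover have "0 \<le> 1 - \<beta> * \<sigma> / (2 * g)" using \<beta>\<sigma> g by (simp add: divide_le_eq)
    ultimately have "(F * q) * (1 - \<beta> * \<sigma> / (2 * g)) \<le> 0" by (rule mult_nonpos_nonneg)
    with pos show False by linarith
  qed
qed

section \<open>Chain rule and integral on an interval of values\<close>

text \<open>The outer functions are differentiable only within an interval, an endpoint of which may
  be a value of \<open>u\<close> in the domain. Since \<open>h\<close> maps a neighbourhood of
  \<open>t\<close> into \<open>J\<close>, the composition still has a two-sided derivative.\<close>

lemma DERIV_chain_within_image: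
  fixes G h :: "real \<Rightarrow> real"
  assumes G: "(G has_real_derivative D) (at (h t) within J)" and h: "(h has_real_derivative E) (at t)"
    and r: "0 < r" and J: "\<And>s. \<bar>s - t\<bar> < r \<Longrightarrow> h s \<in> J"
  shows "((\<lambda>s. G (h s)) has_real_derivative D * E) (at t)"
proof -
  have o: "open (ball t r)" "t \<in> ball t r" using r by auto
  have "(G has_real_derivative D) (at (h t) within h ` ball t r)"
    by (rule has_field_derivative_subset[OF G]) (use J in \<open>auto simp: dist_real_def abs_minus_commute\<close>)
  from DERIV_image_chain[OF this has_field_derivative_at_within[OF h]]
  show ?thesis unfolding at_within_open[OF o(2,1)] by (simp add: o_def)
qed

text \<open>The fundamental theorem is applied with base point 0, which lies in the interval;
  reversing the endpoints gives the minus sign, for \<open>t\<close> on either side of 0.\<close>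

lemma integral_sqrt_derivative:
  fixes f :: "real \<Rightarrow> real"
  assumes f: "continuous_on {a..b} f" and 0: "a \<le> 0" "0 \<le> b" and t: "t \<in> {a..b}"
  shows "((\<lambda>t. LBINT s = ereal t..ereal 0. sqrt (f s)) has_real_derivative - sqrt (f t)) (at t within {a..b})"
proof -
  have "((\<lambda>t. LBINT s = ereal 0..ereal t. sqrt (f s)) has_vector_derivative sqrt (f t)) (at t within {a..b})"
    using t 0 by (intro interval_integral_FTC2 continuous_intros f) auto
  then have "((\<lambda>t. - (LBINT s = ereal 0..ereal t. sqrt (f s))) has_real_derivative - sqrt (f t)) (at t within {a..b})"
    unfolding has_real_derivative_iff_has_vector_derivative by (rule has_vector_derivative_minus)
  then show ?thesis
    by (subst interval_integral_endpoints_reverse) simp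
qed

section \<open>Eigenbasis formulas for the linearised operator\<close>

text \<open>The last formula holds because \<open>S2_grad A\<close> has the same eigenvectors as
  \<open>A\<close>, with eigenvalues \<open>trace A - d i\<close>; contracting it with
  \<open>K\<close> therefore weights the values of the quadratic form of \<open>K\<close> on the
  eigenbasis.\<close>

lemma orthogonal_diagonalization_sums:
  fixes A P :: "real^'n^'n" and d :: "'n \<Rightarrow> real"
  assumes P: "orthogonal_matrix P"
    and A: "A = P ** (\<chi> i j. if i = j then d i else 0) ** transpose P"
  shows "A *v column i P = d i *\<^sub>R column i P"
    and "column i P \<bullet> column i P = 1"
    and "trace A = (\<Sum>i\<in>UNIV. d i)"
    and "(\<Sum>i\<in>UNIV. (column i P \<bullet> v)\<^sup>2) = v \<bullet> v"
    and "(\<Sum>i\<in>UNIV. (trace A - d i) * (column i P \<bullet> (K *v column i P)))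
      = (\<Sum>a\<in>UNIV. \<Sum>b\<in>UNIV. S2_grad A $ a $ b * K $ a $ b)"
proof -
  let ?D = "(\<chi> i j. if i = j then d i else 0) :: real^'n^'n"
  have PtP: "transpose P ** P = mat 1" and PPt: "P ** transpose P = mat 1"
    using P by (simp_all add: orthogonal_matrix_def)
  have col: "column i P = P *v axis i 1" for i
    by (simp add: matrix_vector_mult_basis)
  have Dax: "?D *v axis i 1 = d i *\<^sub>R axis i 1" for i
    unfolding matrix_vector_mult_basis by (auto simp: vec_eq_iff column_def axis_def)
  have "A *v column i P = P *v (?D *v ((transpose P ** P) *v axis i 1))"
    unfolding A col by (simp only: matrix_vector_mul_assoc matrix_mul_assoc)
  then show "A *v column i P = d i *\<^sub>R column i P"
    by (simp add: PtP Dax matrix_vector_mult_scaleR col)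
  have on: "column i P \<bullet> column i P = 1" for i
  proof -
    have "(transpose P ** P) $ i $ i = 1" by (simp add: PtP mat_def)
    then show ?thesis by (simp add: matrix_matrix_mult_def transpose_def column_def inner_vec_def)
  qed
  then show "column i P \<bullet> column i P = 1" .
  have entry: "A $ a $ b = (\<Sum>i\<in>UNIV. d i * (P $ a $ i * P $ b $ i))" for a b
    unfolding A by (simp add: matrix_matrix_mult_def transpose_def if_distrib if_distribR
        mult.commute mult.left_commute cong: if_cong)
  have delta: "(\<Sum>i\<in>UNIV. P $ a $ i * P $ b $ i) = (if a = b then 1 else 0)" for a b
  proof -
    have "(P ** transpose P) $ a $ b = (if a = b then 1 else 0)" by (simp add: PPt mat_def)
    then show ?thesis by (simp add: matrix_matrix_mult_def transpose_def)
  qed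
  have "trace A = (\<Sum>i\<in>UNIV. \<Sum>a\<in>UNIV. d i * (P $ a $ i * P $ a $ i))"
    unfolding trace_def entry by (rule sum.swap)
  also have "\<dots> = (\<Sum>i\<in>UNIV. d i * (column i P \<bullet> column i P))"
    by (simp add: column_def inner_vec_def sum_distrib_left)
  finally show "trace A = (\<Sum>i\<in>UNIV. d i)" by (simp add: on)
  have "v \<bullet> v = v \<bullet> ((P ** transpose P) *v v)" by (simp add: PPt)
  also have "\<dots> = (transpose P *v v) \<bullet> (transpose P *v v)"
    by (metis dot_lmul_matrix matrix_vector_mul_assoc transpose_matrix_vector)
  also have "\<dots> = (\<Sum>i\<in>UNIV. (column i P \<bullet> v)\<^sup>2)"
    by (simp add: inner_vec_def matrix_vector_mult_def transpose_def column_def power2_eq_square)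
  finally show "(\<Sum>i\<in>UNIV. (column i P \<bullet> v)\<^sup>2) = v \<bullet> v" by simp
  have grad: "S2_grad A $ a $ b = (\<Sum>i\<in>UNIV. (trace A - d i) * (P $ a $ i * P $ b $ i))" for a b
    by (simp add: S2_grad_def mat_def entry left_diff_distrib sum_subtractf delta
        flip: sum_distrib_left)
  have quad: "(trace A - d i) * (column i P \<bullet> (K *v column i P))
      = (\<Sum>a\<in>UNIV. \<Sum>b\<in>UNIV. (trace A - d i) * (P $ a $ i * P $ b $ i) * K $ a $ b)" for i
    by (simp add: inner_vec_def matrix_vector_mult_def column_def sum_distrib_left mult_ac)
  have "(\<Sum>i\<in>UNIV. (trace A - d i) * (column i P \<bullet> (K *v column i P)))
      = (\<Sum>a\<in>UNIV. \<Sum>i\<in>UNIV. \<Sum>b\<in>UNIV. (trace A - d i) * (P $ a $ i * P $ b $ i) * K $ a $ b)"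
    unfolding quad by (rule sum.swap)
  also have "\<dots> = (\<Sum>a\<in>UNIV. \<Sum>b\<in>UNIV. \<Sum>i\<in>UNIV. (trace A - d i) * (P $ a $ i * P $ b $ i) * K $ a $ b)"
    by (intro sum.cong refl sum.swap)
  finally show "(\<Sum>i\<in>UNIV. (trace A - d i) * (column i P \<bullet> (K *v column i P)))
      = (\<Sum>a\<in>UNIV. \<Sum>b\<in>UNIV. S2_grad A $ a $ b * K $ a $ b)"
    by (simp add: grad sum_distrib_right)
qed

lemma S2_grad_sum:
  fixes A K :: "real^'n^'n"
  shows "(\<Sum>a\<in>UNIV. \<Sum>b\<in>UNIV. S2_grad A $ a $ b * K $ a $ b)
    = trace A * trace K - (\<Sum>a\<in>UNIV. \<Sum>b\<in>UNIV. A $ a $ b * K $ a $ b)"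
proof -
  have "S2_grad A $ a $ b * K $ a $ b
      = (if b = a then trace A * K $ a $ a else 0) - A $ a $ b * K $ a $ b" for a b
    by (simp add: S2_grad_def mat_def left_diff_distrib)
  then show ?thesis by (simp add: sum_subtractf trace_def[of K] sum_distrib_left)
qed

lemma S2_entries:
  fixes A :: "real^'n^'n"
  assumes "transpose A = A"
  shows "S2 A = ((trace A)\<^sup>2 - (\<Sum>a\<in>UNIV. \<Sum>b\<in>UNIV. (A $ a $ b)\<^sup>2)) / 2"
proof -
  have "A $ b $ a = A $ a $ b" for a b using assms by (metis transpose_def vec_lambda_beta)
  then show ?thesis
    by (simp add: S2_symmetric[OF assms] trace_def matrix_matrix_mult_def power2_eq_square)
qed

lemma hessian_mult_component:
  fixes g :: "real^'n \<Rightarrow> real"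
  shows "(hessian g x *v p) $ k = gradient (partial_deriv k g) x \<bullet> p"
  by (simp add: hessian_def gradient_def matrix_vector_mult_def inner_vec_def)

lemma transpose_hessian:
  fixes g :: "real^'n \<Rightarrow> real"
  assumes "open S" "x \<in> S" "\<And>y. y \<in> S \<Longrightarrow> g differentiable (at y)"
    and "\<And>i. partial_deriv i g differentiable (at x)"
  shows "transpose (hessian g x) = hessian g x"
  using partial_deriv_commute[OF assms] by (simp add: vec_eq_iff transpose_def hessian_def)

section \<open>Differentiating the equation\<close>

text \<open>Both sides of the equation are restricted to a line in direction \<open>k\<close> and
  differentiated at \<open>x\<close>. The result eliminates the third derivatives of
  \<open>u\<close> from the contracted Hessian of the P-function.\<close>

lemma S2_equation_partial_deriv:
  fixes u :: "real^'n \<Rightarrow> real" and f :: "real \<Rightarrow> real"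
  assumes \<Omega>: "open \<Omega>" "x \<in> \<Omega>"
    and u1: "\<And>y. y \<in> \<Omega> \<Longrightarrow> u differentiable (at y)"
    and u2: "\<And>y i. y \<in> \<Omega> \<Longrightarrow> partial_deriv i u differentiable (at y)"
    and u3: "\<And>y i j. y \<in> \<Omega> \<Longrightarrow> partial_deriv j (partial_deriv i u) differentiable (at y)"
    and J: "u ` \<Omega> \<subseteq> J" and f: "(f has_real_derivative c) (at (u x) within J)"
    and eq: "\<And>y. y \<in> \<Omega> \<Longrightarrow> S2 (hessian u y) = f (u y)"
  shows "(\<Sum>a\<in>UNIV. \<Sum>b\<in>UNIV. S2_grad (hessian u x) $ a $ b * hessian (partial_deriv k u) x $ a $ b)
    = c * partial_deriv k u x"
proof -
  define e :: "real^'n" where "e = axis k 1"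
  obtain r where r: "0 < r" "ball x r \<subseteq> \<Omega>" using \<Omega> openE by blast
  have in\<Omega>: "x + t *\<^sub>R e \<in> \<Omega>" if "\<bar>t\<bar> < r" for t
    using that by (intro subsetD[OF r(2)]) (simp add: e_def dist_norm)
  have along: "((\<lambda>t. g (x + t *\<^sub>R e)) has_real_derivative partial_deriv k g x) (at 0)"
    if "g differentiable (at x)" for g
    using has_real_derivative_along_line[of g x 0 e] that by (simp add: e_def inner_axis gradient_def)
  define h where "h a b t = hessian u (x + t *\<^sub>R e) $ a $ b" for a b t
  define K where "K = hessian (partial_deriv k u) x"
  have h: "(h a b has_real_derivative K $ a $ b) (at 0)" for a b
  proof -
    \<comment> \<open>The index \<open>k\<close> is moved inwards in two steps; the inner exchange
      holds in all of \<open>\<Omega>\<close>, so it may be performed under the outer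
      derivative.\<close>
    have "partial_deriv k (partial_deriv b (partial_deriv a u)) x
        = partial_deriv b (partial_deriv k (partial_deriv a u)) x"
      using partial_deriv_commute[OF \<Omega> u2 u3[OF \<Omega>(2)]] .
    also have "\<dots> = partial_deriv b (partial_deriv a (partial_deriv k u)) x"
      unfolding partial_deriv_def[of b]
      using frechet_derivative_transform_within_open[OF u3[OF \<Omega>(2)] \<Omega> partial_deriv_commute[OF \<Omega>(1) _ u1 u2]]
      by metis
    finally have "partial_deriv k (partial_deriv b (partial_deriv a u)) x = K $ a $ b"
      by (simp add: K_def hessian_def)
    moreover have "h a b = (\<lambda>t. partial_deriv b (partial_deriv a u) (x + t *\<^sub>R e))"
      by (simp add: h_def hessian_def fun_eq_iff)
    ultimately show ?thesis using along[OF u3[OF \<Omega>(2), of b a]] by simp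
  qed
  \<comment> \<open>\<open>S2\<close> is defined through a sorted list of eigenvalues.
    \<open>F\<close> is the polynomial in the matrix entries that agrees with it for symmetric
    matrices, and it can be differentiated term by term.\<close>
  define F where "F t = ((\<Sum>a\<in>UNIV. h a a t)\<^sup>2 - (\<Sum>a\<in>UNIV. \<Sum>b\<in>UNIV. (h a b t)\<^sup>2)) / 2" for t
  have sq: "((\<lambda>t. (y t)\<^sup>2) has_real_derivative 2 * (y 0 * D)) (at 0)"
    if "(y has_real_derivative D) (at 0)" for y D
    using DERIV_power[OF that, of 2] by (simp add: mult.commute)
  have "(F has_real_derivative (2 * ((\<Sum>a\<in>UNIV. h a a 0) * (\<Sum>a\<in>UNIV. K $ a $ a))
      - (\<Sum>a\<in>UNIV. \<Sum>b\<in>UNIV. 2 * (h a b 0 * K $ a $ b))) / 2) (at 0)"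
    unfolding F_def by (intro DERIV_cdivide DERIV_diff sq DERIV_sum h)
  then have "(F has_real_derivative (\<Sum>a\<in>UNIV. h a a 0) * (\<Sum>a\<in>UNIV. K $ a $ a)
      - (\<Sum>a\<in>UNIV. \<Sum>b\<in>UNIV. h a b 0 * K $ a $ b)) (at 0)"
    by (simp add: diff_divide_distrib flip: sum_distrib_left)
  then have DF: "(F has_real_derivative
      (\<Sum>a\<in>UNIV. \<Sum>b\<in>UNIV. S2_grad (hessian u x) $ a $ b * K $ a $ b)) (at 0)"
    by (simp add: S2_grad_sum trace_def h_def)
  have Ff: "F t = f (u (x + t *\<^sub>R e))" if "\<bar>t\<bar> < r" for t
    using eq[OF in\<Omega>[OF that]] S2_entries[OF transpose_hessian[OF \<Omega>(1) in\<Omega>[OF that] u1 u2[OF in\<Omega>[OF that]]]]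
    by (simp add: F_def h_def trace_def)
  have "((\<lambda>t. f (u (x + t *\<^sub>R e))) has_real_derivative c * partial_deriv k u x) (at 0)"
    by (rule DERIV_chain_within_image[where J = J and r = r])
      (use f along[OF u1[OF \<Omega>(2)]] r J in\<Omega> in auto)
  then have "(F has_real_derivative c * partial_deriv k u x) (at 0)"
    by (rule has_field_derivative_transform_within_open[where S = "ball 0 r"])
      (use r Ff in auto)
  from DERIV_unique[OF DF this] show ?thesis by (simp add: K_def)
qed

section \<open>First- and second-order conditions for the P-function\<close>

text \<open>Differentiating the P-function twice along lines through \<open>x\<close> and choosing
  eigenvectors of the Hessian as directions yields the hypotheses of
  \<open>eigenvalue_inequalities_contradiction\<close>. The convexity assumption enters through
  \<open>tangential\<close>.\<close>

lemma P_function_no_interior_min: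
  fixes u :: "real^'n \<Rightarrow> real" and f f' G :: "real \<Rightarrow> real"
  assumes \<Omega>: "open \<Omega>" "x \<in> \<Omega>"
    and u1: "\<And>y. y \<in> \<Omega> \<Longrightarrow> u differentiable (at y)"
    and u2: "\<And>y i. y \<in> \<Omega> \<Longrightarrow> partial_deriv i u differentiable (at y)"
    and u3: "\<And>y i j. y \<in> \<Omega> \<Longrightarrow> partial_deriv j (partial_deriv i u) differentiable (at y)"
    and J: "u ` \<Omega> \<subseteq> J"
    and f_pos: "\<And>t. t \<in> J \<Longrightarrow> 0 < f t"
    and f': "\<And>t. t \<in> J \<Longrightarrow> (f has_real_derivative f' t) (at t within J)"
    and f'_le: "\<And>t. t \<in> J \<Longrightarrow> f' t \<le> 0"
    and G: "\<And>t. t \<in> J \<Longrightarrow> (G has_real_derivative - sqrt (f t)) (at t within J)"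
    and adm: "pos_def (S2_grad (hessian u x))"
    and eq: "\<And>y. y \<in> \<Omega> \<Longrightarrow> S2 (hessian u y) = f (u y)"
    and \<beta>: "1 < \<beta>"
    and tangential: "\<And>v. gradient u x \<bullet> v = 0 \<Longrightarrow> 0 \<le> v \<bullet> (hessian u x *v v)"
    and min: "\<And>y. y \<in> \<Omega> \<Longrightarrow> gradient u x \<bullet> gradient u x + 2 * \<beta> * G (u x)
      \<le> gradient u y \<bullet> gradient u y + 2 * \<beta> * G (u y)"
  shows False
proof -
  define A where "A = hessian u x"
  define g where "g = sqrt (f (u x))"
  define m where "m = \<beta> * g"
  define F where "F = f' (u x)"
  define n where "n = gradient u x"
  define K where "K k = hessian (partial_deriv k u) x" for k
  have uJ: "u y \<in> J" if "y \<in> \<Omega>" for y using that J by blast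
  have g: "0 < g" "g\<^sup>2 = f (u x)" using f_pos[OF uJ[OF \<Omega>(2)]] by (auto simp: g_def)
  have At: "transpose A = A" unfolding A_def by (rule transpose_hessian[OF \<Omega> u1 u2[OF \<Omega>(2)]])
  obtain r where r: "0 < r" "ball x r \<subseteq> \<Omega>" using \<Omega> openE by blast
  have r0: "\<bar>0 :: real\<bar> < r" using r(1) by simp
  \<comment> \<open>These are the vanishing of the first derivative of \<open>\<phi>\<close> at 0
    and the nonnegativity of its second derivative, both divided by 2. As \<open>A\<close> is
    symmetric, the first one says that \<open>n\<close> is zero or an eigenvector for
    \<open>m\<close>.\<close>
  have second_order: "n \<bullet> (A *v p) = m * (n \<bullet> p)"
      "0 \<le> (A *v p) \<bullet> (A *v p) + (\<Sum>k\<in>UNIV. n $ k * (p \<bullet> (K k *v p)))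
        - \<beta> * (F / (2 * g)) * (p \<bullet> n)\<^sup>2 - m * (p \<bullet> (A *v p))" if p: "norm p = 1" for p
  proof -
    have in\<Omega>: "x + t *\<^sub>R p \<in> \<Omega>" if "\<bar>t\<bar> < r" for t
      using that p by (intro subsetD[OF r(2)]) (simp add: dist_norm)
    define \<phi> where "\<phi> t = gradient u (x + t *\<^sub>R p) \<bullet> gradient u (x + t *\<^sub>R p)
      + 2 * \<beta> * G (u (x + t *\<^sub>R p))" for t
    define \<phi>' where "\<phi>' t = 2 * (gradient u (x + t *\<^sub>R p) \<bullet> (hessian u (x + t *\<^sub>R p) *v p))
      - 2 * \<beta> * (sqrt (f (u (x + t *\<^sub>R p))) * (gradient u (x + t *\<^sub>R p) \<bullet> p))" for t
    have near: "\<exists>r'>0. \<forall>s. \<bar>s - t\<bar> < r' \<longrightarrow> u (x + s *\<^sub>R p) \<in> J" if "\<bar>t\<bar> < r" for t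
      using that by (intro exI[of _ "r - \<bar>t\<bar>"]) (auto intro!: uJ in\<Omega>)
    have du: "((\<lambda>t. u (x + t *\<^sub>R p)) has_real_derivative gradient u (x + t *\<^sub>R p) \<bullet> p) (at t)"
      if "\<bar>t\<bar> < r" for t
      by (intro has_real_derivative_along_line u1 in\<Omega> that)
    have dk: "((\<lambda>t. partial_deriv k u (x + t *\<^sub>R p)) has_real_derivative (hessian u (x + t *\<^sub>R p) *v p) $ k) (at t)"
      if "\<bar>t\<bar> < r" for t k
      unfolding hessian_mult_component by (intro has_real_derivative_along_line u2 in\<Omega> that)
    have dG: "((\<lambda>t. G (u (x + t *\<^sub>R p))) has_real_derivative
        - sqrt (f (u (x + t *\<^sub>R p))) * (gradient u (x + t *\<^sub>R p) \<bullet> p)) (at t)" if t: "\<bar>t\<bar> < r" for t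
    proof -
      obtain r' where "r' > 0" "\<And>s. \<bar>s - t\<bar> < r' \<Longrightarrow> u (x + s *\<^sub>R p) \<in> J" using near[OF t] by blast
      with DERIV_chain_within_image[OF G[OF uJ[OF in\<Omega>[OF t]]] du[OF t]] show ?thesis by blast
    qed
    have d\<phi>: "(\<phi> has_real_derivative \<phi>' t) (at t)" if t: "\<bar>t\<bar> < r" for t
    proof -
      have "((\<lambda>t. \<Sum>k\<in>UNIV. (partial_deriv k u (x + t *\<^sub>R p))\<^sup>2) has_real_derivative
          (\<Sum>k\<in>UNIV. 2 * (partial_deriv k u (x + t *\<^sub>R p) * (hessian u (x + t *\<^sub>R p) *v p) $ k))) (at t)"
        using DERIV_power[OF dk[OF t], where n = 2] by (intro DERIV_sum) (simp add: mult_ac)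
      then have "((\<lambda>t. gradient u (x + t *\<^sub>R p) \<bullet> gradient u (x + t *\<^sub>R p)) has_real_derivative
          2 * (gradient u (x + t *\<^sub>R p) \<bullet> (hessian u (x + t *\<^sub>R p) *v p))) (at t)"
        by (simp add: inner_vec_def gradient_def power2_eq_square flip: sum_distrib_left)
      from DERIV_add[OF this DERIV_cmult[OF dG[OF t], of "2 * \<beta>"]]
      show ?thesis by (simp add: \<phi>_def[abs_def] \<phi>'_def)
    qed
    have min0: "\<phi> 0 \<le> \<phi> t" if "\<bar>t\<bar> < r" for t
      using min[OF in\<Omega>[OF that]] by (simp add: \<phi>_def)
    have \<phi>'0: "\<phi>' 0 = 0"
      by (rule DERIV_local_min[OF d\<phi>[of 0] r(1)]) (use r min0 in auto)
    then show "n \<bullet> (A *v p) = m * (n \<bullet> p)" by (simp add: \<phi>'_def n_def A_def m_def g_def)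
    have dsqrt: "((\<lambda>t. sqrt (f (u (x + t *\<^sub>R p)))) has_real_derivative F / (2 * g) * (n \<bullet> p)) (at 0)"
    proof -
      obtain r' where r': "r' > 0" "\<And>s. \<bar>s - 0\<bar> < r' \<Longrightarrow> u (x + s *\<^sub>R p) \<in> J" using near[of 0] r by auto
      have "((\<lambda>t. f (u (x + t *\<^sub>R p))) has_real_derivative F * (n \<bullet> p)) (at 0)"
        using DERIV_chain_within_image[where t = 0, OF _ du[OF r0] r', of f F] f'[OF uJ[OF \<Omega>(2)]]
        by (simp add: F_def n_def)
      from DERIV_chain2[OF DERIV_real_sqrt[OF f_pos[OF uJ[OF in\<Omega>[of 0]]]] this] r(1)
      show ?thesis by (simp add: g_def field_simps)
    qed
    have dH: "((\<lambda>t. (hessian u (x + t *\<^sub>R p) *v p) $ k) has_real_derivative p \<bullet> (K k *v p)) (at 0)" for k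
    proof -
      have "((\<lambda>t. partial_deriv j (partial_deriv k u) (x + t *\<^sub>R p)) has_real_derivative (K k *v p) $ j) (at 0)" for j
        using has_real_derivative_along_line[of "partial_deriv j (partial_deriv k u)" x 0 p] u3[OF \<Omega>(2)]
        by (simp add: K_def hessian_mult_component)
      then have "((\<lambda>t. \<Sum>j\<in>UNIV. partial_deriv j (partial_deriv k u) (x + t *\<^sub>R p) * p $ j)
          has_real_derivative (\<Sum>j\<in>UNIV. (K k *v p) $ j * p $ j)) (at 0)"
        by (intro DERIV_sum DERIV_cmult_right)
      then show ?thesis
        by (simp add: hessian_mult_component gradient_def inner_vec_def mult.commute)
    qed
    define X where "X = (A *v p) \<bullet> (A *v p) + (\<Sum>k\<in>UNIV. n $ k * (p \<bullet> (K k *v p)))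
        - \<beta> * (F / (2 * g)) * (p \<bullet> n)\<^sup>2 - m * (p \<bullet> (A *v p))"
    define c where "c = 2 * X"
    have du2: "((\<lambda>t. gradient u (x + t *\<^sub>R p) \<bullet> p) has_real_derivative (A *v p) \<bullet> p) (at 0)"
    proof -
      have "((\<lambda>t. \<Sum>k\<in>UNIV. partial_deriv k u (x + t *\<^sub>R p) * p $ k) has_real_derivative
          (\<Sum>k\<in>UNIV. (A *v p) $ k * p $ k)) (at 0)"
        using dk[OF r0] by (intro DERIV_sum DERIV_cmult_right) (simp add: A_def)
      then show ?thesis by (simp add: inner_vec_def gradient_def)
    qed
    have dgH: "((\<lambda>t. gradient u (x + t *\<^sub>R p) \<bullet> (hessian u (x + t *\<^sub>R p) *v p)) has_real_derivative
        (\<Sum>k\<in>UNIV. (A *v p) $ k * (A *v p) $ k + p \<bullet> (K k *v p) * n $ k)) (at 0)"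
    proof -
      have "((\<lambda>t. partial_deriv k u (x + t *\<^sub>R p) * (hessian u (x + t *\<^sub>R p) *v p) $ k) has_real_derivative
         (A *v p) $ k * (A *v p) $ k + p \<bullet> (K k *v p) * n $ k) (at 0)" for k
        using DERIV_mult[OF dk[of 0 k] dH[of k]] r(1) by (simp add: A_def n_def gradient_def)
      then have "((\<lambda>t. \<Sum>k\<in>UNIV. partial_deriv k u (x + t *\<^sub>R p) * (hessian u (x + t *\<^sub>R p) *v p) $ k)
          has_real_derivative (\<Sum>k\<in>UNIV. (A *v p) $ k * (A *v p) $ k + p \<bullet> (K k *v p) * n $ k)) (at 0)"
        by (intro DERIV_sum)
      moreover have "gradient u y \<bullet> z = (\<Sum>k\<in>UNIV. partial_deriv k u y * z $ k)" for y z
        by (simp add: inner_vec_def gradient_def)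
      ultimately show ?thesis by simp
    qed
    have d\<phi>': "(\<phi>' has_real_derivative c) (at 0)"
      unfolding \<phi>'_def[abs_def]
    proof (rule DERIV_cong[OF DERIV_diff[OF DERIV_cmult[OF dgH] DERIV_cmult[OF DERIV_mult[OF dsqrt du2]]]])
      have sums: "(\<Sum>k\<in>UNIV. (A *v p) $ k * (A *v p) $ k + p \<bullet> (K k *v p) * n $ k)
          = (A *v p) \<bullet> (A *v p) + (\<Sum>k\<in>UNIV. n $ k * (p \<bullet> (K k *v p)))"
        by (simp add: sum.distrib inner_vec_def[of "A *v p" "A *v p"] mult.commute)
      have base: "sqrt (f (u (x + 0 *\<^sub>R p))) = g" "gradient u (x + 0 *\<^sub>R p) = n"
        by (simp_all add: g_def n_def)
      show "2 * (\<Sum>k\<in>UNIV. (A *v p) $ k * (A *v p) $ k + p \<bullet> (K k *v p) * n $ k)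
          - 2 * \<beta> * (F / (2 * g) * (n \<bullet> p) * (gradient u (x + 0 *\<^sub>R p) \<bullet> p)
            + (A *v p) \<bullet> p * sqrt (f (u (x + 0 *\<^sub>R p)))) = c"
        unfolding sums base c_def X_def m_def inner_commute[of n p] inner_commute[of "A *v p" p]
        by (simp add: power2_eq_square right_diff_distrib distrib_left)
    qed
    have "0 \<le> c"
    proof (rule ccontr)
      assume "\<not> 0 \<le> c"
      then obtain \<delta> where \<delta>: "0 < \<delta>" "\<And>t. t \<noteq> 0 \<Longrightarrow> \<bar>t\<bar> < \<delta> \<Longrightarrow> \<phi> t < \<phi> 0"
        using second_derivative_neg_imp_strict_local_max[OF r(1) d\<phi> \<phi>'0 d\<phi>'] by auto
      define s where "s = min r \<delta> / 2"
      have "0 < s" "s < r" "s < \<delta>" using r(1) \<delta>(1) by (auto simp: s_def)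
      then show False using min0[of s] \<delta>(2)[of s] by simp
    qed
    then show "0 \<le> (A *v p) \<bullet> (A *v p) + (\<Sum>k\<in>UNIV. n $ k * (p \<bullet> (K k *v p)))
        - \<beta> * (F / (2 * g)) * (p \<bullet> n)\<^sup>2 - m * (p \<bullet> (A *v p))"
      unfolding X_def[symmetric] by (simp add: c_def)
  qed
  obtain P d where P: "orthogonal_matrix P" and AP: "A = P ** (\<chi> i j. if i = j then d i else 0) ** transpose P"
    by (rule symmetric_diagonalize[OF At])
  note sums = orthogonal_diagonalization_sums[OF P AP]
  define p where "p i = column i P" for i
  define w where "w i = p i \<bullet> n" for i
  define \<rho> where "\<rho> i = (\<Sum>k\<in>UNIV. n $ k * (p i \<bullet> (K k *v p i)))" for i
  have Ap: "A *v p i = d i *\<^sub>R p i" and pp: "p i \<bullet> p i = 1" for i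
    unfolding p_def by (fact sums)+
  have np: "norm (p i) = 1" for i using pp[of i] by (simp add: norm_eq_1)
  have w_sum: "(\<Sum>i\<in>UNIV. (w i)\<^sup>2) = n \<bullet> n" unfolding w_def p_def by (fact sums)
  have n0: "n = 0" if "\<And>j. w j = 0" using w_sum that by simp
  have dw: "d i * w i = m * w i" for i
    using second_order(1)[OF np[of i]] by (simp add: Ap w_def inner_commute)
  have m0: "0 < m" using g \<beta> by (simp add: m_def)
  show False
  proof (rule eigenvalue_inequalities_contradiction[where d = d and w = w and r = \<rho> and T = "trace A"
        and g = g and m = m and \<beta> = \<beta> and F = F])
    \<comment> \<open>An eigenvector orthogonal to the gradient is covered by
      \<open>tangential\<close>; for any other, \<open>dw\<close> gives
      \<open>d i = m\<close>.\<close>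
    show "0 \<le> d i" for i
    proof (cases "w i = 0")
      case True
      then have "0 \<le> p i \<bullet> (A *v p i)"
        unfolding A_def by (intro tangential) (simp add: w_def n_def inner_commute)
      then show ?thesis by (simp add: Ap pp)
    qed (use dw[of i] m0 in simp)
    show "0 < trace A - d i" for i
    proof -
      have "p i \<noteq> 0" using pp[of i] by auto
      then have "0 < p i \<bullet> (S2_grad A *v p i)" using adm by (simp add: pos_def_def A_def)
      moreover have "mat t *v v = t *\<^sub>R v" for t and v :: "real^'n"
        by (simp add: vec_eq_iff matrix_vector_mult_def mat_def if_distrib if_distribR cong: if_cong)
      ultimately show ?thesis
        by (simp add: S2_grad_def matrix_vector_mult_diff_rdistrib Ap inner_diff_right pp)
    qed
    show "trace A = (\<Sum>i\<in>UNIV. d i)" by (fact sums)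
    \<comment> \<open>Euler's identity: \<open>S2\<close> is homogeneous of degree 2, so its
      gradient contracted with \<open>A\<close> is twice its value.\<close>
    have "(\<Sum>i\<in>UNIV. (trace A - d i) * d i) = (\<Sum>i\<in>UNIV. (trace A - d i) * (p i \<bullet> (A *v p i)))"
      by (simp add: Ap pp)
    also have "\<dots> = 2 * S2 A"
      unfolding p_def sums(5) S2_grad_sum S2_entries[OF At] by (simp add: power2_eq_square)
    also have "S2 A = g\<^sup>2" using eq[OF \<Omega>(2)] g by (simp add: A_def)
    finally show "(\<Sum>i\<in>UNIV. (trace A - d i) * d i) = 2 * g\<^sup>2" .
    show "F \<le> 0" using f'_le uJ \<Omega> by (simp add: F_def)
    have "(\<Sum>i\<in>UNIV. (trace A - d i) * \<rho> i)
        = (\<Sum>k\<in>UNIV. n $ k * (\<Sum>i\<in>UNIV. (trace A - d i) * (p i \<bullet> (K k *v p i))))"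
      unfolding \<rho>_def sum_distrib_left by (subst sum.swap) (simp add: mult_ac)
    also have "\<dots> = (\<Sum>k\<in>UNIV. n $ k * (F * n $ k))"
      unfolding p_def sums(5) unfolding K_def A_def F_def
      using S2_equation_partial_deriv[OF \<Omega> u1 u2 u3 J f'[OF uJ[OF \<Omega>(2)]] eq]
      by (simp add: n_def gradient_def)
    also have "\<dots> = F * (n \<bullet> n)"
      by (simp add: inner_vec_def sum_distrib_left mult_ac)
    finally show "(\<Sum>i\<in>UNIV. (trace A - d i) * \<rho> i) = F * (\<Sum>i\<in>UNIV. (w i)\<^sup>2)" by (simp add: w_sum)
    show "\<rho> i = 0" if "\<And>j. w j = 0" for i using n0[OF that] by (simp add: \<rho>_def)
    show "0 \<le> (d i)\<^sup>2 + \<rho> i - \<beta> * (F / (2 * g)) * (w i)\<^sup>2 - m * d i" for i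
      using second_order(2)[OF np[of i]] by (simp add: Ap pp \<rho>_def w_def power2_eq_square)
  qed (intro g(1) \<beta> m_def dw)+
qed

section \<open>Convexity in directions tangent to the level sets\<close>

text \<open>If \<open>v\<close> is orthogonal to the gradient and the quadratic form were negative
  at \<open>v\<close>, then \<open>u\<close> would be smaller at two points symmetric about
  \<open>x\<close> than at \<open>x\<close>. As \<open>U\<close> is strictly increasing, this
  contradicts midpoint convexity of the composition.\<close>

lemma quasiconvex_tangential_hessian_nonneg:
  fixes u :: "real^'n \<Rightarrow> real"
  assumes \<Omega>: "open \<Omega>" "x \<in> \<Omega>"
    and u1: "\<And>y. y \<in> \<Omega> \<Longrightarrow> u differentiable (at y)"
    and u2: "\<And>i. partial_deriv i u differentiable (at x)"
    and U: "strict_mono_on I U" "u ` \<Omega> \<subseteq> I" "convex_on \<Omega> (\<lambda>x. U (u x))"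
    and v: "gradient u x \<bullet> v = 0"
  shows "0 \<le> v \<bullet> (hessian u x *v v)"
proof (rule ccontr)
  assume neg: "\<not> 0 \<le> v \<bullet> (hessian u x *v v)"
  then have v0: "v \<noteq> 0" by auto
  obtain r where r: "0 < r" "ball x r \<subseteq> \<Omega>" using \<Omega> openE by blast
  define r' where "r' = r / norm v"
  have r': "0 < r'" using r v0 by (simp add: r'_def)
  have in\<Omega>: "x + t *\<^sub>R v \<in> \<Omega>" if "\<bar>t\<bar> < r'" for t
    using that v0 by (intro subsetD[OF r(2)]) (simp add: dist_norm r'_def less_divide_eq)
  have "((\<lambda>t. \<Sum>k\<in>UNIV. partial_deriv k u (x + t *\<^sub>R v) * v $ k) has_real_derivative
      (\<Sum>k\<in>UNIV. (gradient (partial_deriv k u) x \<bullet> v) * v $ k)) (at 0)"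
    using has_real_derivative_along_line[of "partial_deriv _ u" x 0 v] u2
    by (intro DERIV_sum DERIV_cmult_right) simp
  moreover have "gradient u y \<bullet> v = (\<Sum>k\<in>UNIV. partial_deriv k u y * v $ k)" for y
    by (simp add: inner_vec_def gradient_def)
  moreover have "v \<bullet> (hessian u x *v v) = (\<Sum>k\<in>UNIV. (gradient (partial_deriv k u) x \<bullet> v) * v $ k)"
    by (simp add: inner_vec_def[of v] hessian_mult_component mult.commute)
  ultimately have "((\<lambda>t. gradient u (x + t *\<^sub>R v) \<bullet> v) has_real_derivative v \<bullet> (hessian u x *v v)) (at 0)"
    by simp
  from second_derivative_neg_imp_strict_local_max[OF r' has_real_derivative_along_line[OF u1[OF in\<Omega>]] _ this]
  obtain \<delta> where \<delta>: "0 < \<delta>" "\<And>t. t \<noteq> 0 \<Longrightarrow> \<bar>t\<bar> < \<delta> \<Longrightarrow> u (x + t *\<^sub>R v) < u x"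
    using neg v by auto
  define t where "t = min r' \<delta> / 2"
  have t: "0 < t" "t < r'" "t < \<delta>" using r' \<delta>(1) by (auto simp: t_def)
  have mem: "x + t *\<^sub>R v \<in> \<Omega>" "x + (- t) *\<^sub>R v \<in> \<Omega>" using t in\<Omega>[of t] in\<Omega>[of "- t"] by simp_all
  have less: "U (u y) < U (u x)" if "u y < u x" "y \<in> \<Omega>" for y
    using U(1,2) \<Omega>(2) that by (auto simp: strict_mono_on_def)
  have "U (u (x + t *\<^sub>R v)) < U (u x)" "U (u (x + (- t) *\<^sub>R v)) < U (u x)"
    using \<delta>(2)[of t] \<delta>(2)[of "- t"] t mem by (auto intro!: less)
  moreover have "(1 - 1/2) *\<^sub>R (x + t *\<^sub>R v) + (1/2) *\<^sub>R (x + (- t) *\<^sub>R v) = x"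
    by (simp add: algebra_simps flip: scaleR_left_distrib)
  ultimately show False
    using convex_onD[OF U(3) _ _ mem, of "1/2"] by simp
qed

section \<open>Location of the minimum over the closure\<close>

theorem theorem3:
  fixes \<Omega> :: "(real^'n) set" and u :: "real^'n \<Rightarrow> real"
    and f f' :: "real \<Rightarrow> real" and J :: "real set"
    and U U' U'' :: "real \<Rightarrow> real" and I :: "real set"
    and \<alpha> :: real
  assumes N: "CARD('n) \<ge> 2"
    and domain: "open \<Omega>" "\<Omega> \<noteq> {}" "bounded \<Omega>" "convex \<Omega>"
    and regularity: "Ck_on 3 u \<Omega>" "Ck_closure 2 u \<Omega>"
    and J: "is_interval J" "u ` closure \<Omega> \<subseteq> J"
    and f_pos: "\<forall>t\<in>J. f t > 0"
    and f_C1: "\<forall>t\<in>J. (f has_real_derivative f' t) (at t within J)" "continuous_on J f'"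
    and admissible: "\<forall>x\<in>\<Omega>. pos_def (S2_grad (hessian u x))"
    and equation: "\<forall>x\<in>\<Omega>. S2 (hessian u x) = f (u x)"
    and boundary: "\<forall>x\<in>frontier \<Omega>. u x = 0"
    and f'_le: "\<forall>t\<in>J. f' t \<le> 0"
    and \<alpha>: "\<alpha> \<ge> 1"
    and I: "is_interval I" "u ` \<Omega> \<subseteq> I"
    and U_strict: "strict_mono_on I U"
    and U_C2: "\<forall>t\<in>I. (U has_real_derivative U' t) (at t within I)"
      "\<forall>t\<in>I. (U' has_real_derivative U'' t) (at t within I)" "continuous_on I U''"
    and U_convex: "convex_on \<Omega> (\<lambda>x. U (u x))"
  shows "\<exists>y\<in>frontier \<Omega>. \<forall>x\<in>closure \<Omega>. Phi \<alpha> f u \<Omega> y \<le> Phi \<alpha> f u \<Omega> x"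
proof -
  have u1: "u differentiable (at y)" if "y \<in> \<Omega>" for y
    using regularity(1) that by (simp add: numeral_3_eq_3)
  have u2: "partial_deriv i u differentiable (at y)" if "y \<in> \<Omega>" for y i
    using regularity(1) that by (simp add: numeral_3_eq_3)
  have u3: "partial_deriv j (partial_deriv i u) differentiable (at y)" if "y \<in> \<Omega>" for y i j
    using regularity(1) that by (simp add: numeral_3_eq_3)
  have cont_u: "continuous_on (closure \<Omega>) u"
    using regularity(2) by (simp add: Ck_closure_def)
  have "\<exists>h. continuous_on (closure \<Omega>) h \<and> (\<forall>x\<in>\<Omega>. h x = partial_deriv i u x)" for i
    using regularity(2) by (simp add: Ck_closure_def numeral_2_eq_2)
  \<comment> \<open>The continuous extensions of the first derivatives make
    \<open>grad_closure\<close>, and hence the P-function, continuous up to the boundary.\<close>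
  then obtain h where h: "\<And>i. continuous_on (closure \<Omega>) (h i)"
      "\<And>i x. x \<in> \<Omega> \<Longrightarrow> h i x = partial_deriv i u x"
    by metis
  define q where "q = grad_closure \<Omega> u"
  have q_h: "q x = (\<chi> i. h i x)" if "x \<in> closure \<Omega>" for x
    using grad_closure_extension[OF domain(1) that h] by (simp add: q_def vec_eq_iff)
  have "continuous_on (closure \<Omega>) (\<lambda>x. \<chi> i. h i x)"
    by (intro continuous_on_vec_lambda h)
  then have cont_q: "continuous_on (closure \<Omega>) q"
    by (rule continuous_on_eq) (simp add: q_h)
  have q_grad: "q x = gradient u x" if "x \<in> \<Omega>" for x
    using q_h[of x] h(2)[OF that] that closure_subset by (auto simp: gradient_def)
  have cpt: "compact (closure \<Omega>)" using domain by (simp add: compact_closure)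
  have fr: "frontier \<Omega> \<noteq> {}"
    using domain by (metis frontier_eq_empty not_bounded_UNIV)
  have fr_cl: "frontier \<Omega> \<subseteq> closure \<Omega>" by (simp add: frontier_def)
  have cl_ne: "closure \<Omega> \<noteq> {}" using domain by simp
  obtain xa where xa: "xa \<in> closure \<Omega>" "\<And>x. x \<in> closure \<Omega> \<Longrightarrow> u xa \<le> u x"
    using continuous_attains_inf[OF cpt cl_ne cont_u] by blast
  obtain xb where xb: "xb \<in> closure \<Omega>" "\<And>x. x \<in> closure \<Omega> \<Longrightarrow> u x \<le> u xb"
    using continuous_attains_sup[OF cpt cl_ne cont_u] by blast
  \<comment> \<open>The exact range of values of \<open>u\<close> on the closure, a compact interval
    inside \<open>J\<close>. It contains 0 because of the boundary condition, so the integral in the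
    P-function stays within the domain of \<open>f\<close>.\<close>
  define K where "K = {u xa..u xb}"
  have KJ: "K \<subseteq> J"
  proof
    fix t assume "t \<in> K"
    have "u xa \<in> J" "u xb \<in> J" using J(2) xa(1) xb(1) by auto
    from mem_is_interval_1_I[OF J(1) this, of t] show "t \<in> J" using \<open>t \<in> K\<close> by (simp add: K_def)
  qed
  have uK: "u ` closure \<Omega> \<subseteq> K" using xa xb by (auto simp: K_def)
  have u0: "u xa \<le> 0" "0 \<le> u xb" 
  proof -
    obtain z where z: "z \<in> frontier \<Omega>" using fr by blast
    then have "u z = 0" "z \<in> closure \<Omega>" using boundary fr_cl by auto
    then show "u xa \<le> 0" "0 \<le> u xb" using xa(2)[of z] xb(2)[of z] by simp_all
  qed
  have f': "(f has_real_derivative f' t) (at t within K)" if "t \<in> K" for t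
    using f_C1(1) KJ that by (meson has_field_derivative_subset subsetD)
  have cont_f: "continuous_on K f" using f' by (rule DERIV_continuous_on)
  define G where "G t = (LBINT s = ereal t..ereal 0. sqrt (f s))" for t
  have G: "(G has_real_derivative - sqrt (f t)) (at t within K)" if "t \<in> K" for t
    using integral_sqrt_derivative[OF cont_f[unfolded K_def] u0] that
    unfolding G_def[abs_def] K_def by blast
  have G0: "G 0 = 0" by (simp add: G_def)
  have Phi: "Phi \<beta> f u \<Omega> x = (norm (q x))\<^sup>2 + 2 * \<beta> * G (u x)" for \<beta> x
    by (simp add: Phi_def q_def G_def)
  have cont_G: "continuous_on (closure \<Omega>) (\<lambda>x. G (u x))"
    using continuous_on_compose2[OF DERIV_continuous_on[OF G] cont_u uK] .
  have cont_Phi: "continuous_on (closure \<Omega>) (Phi \<beta> f u \<Omega>)" for \<beta>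
    unfolding Phi by (intro continuous_intros cont_G cont_q)
  have no_interior_min: "\<not> (\<forall>y\<in>\<Omega>. Phi \<beta> f u \<Omega> x \<le> Phi \<beta> f u \<Omega> y)" if x: "x \<in> \<Omega>" and \<beta>: "1 < \<beta>" for \<beta> x
  proof
    assume min: "\<forall>y\<in>\<Omega>. Phi \<beta> f u \<Omega> x \<le> Phi \<beta> f u \<Omega> y"
    show False
    proof (rule P_function_no_interior_min[OF domain(1) x u1 u2 u3 _ _ f' _ G _ _ \<beta>])
      show "u ` \<Omega> \<subseteq> K" using uK closure_subset by blast
      show "0 \<le> v \<bullet> (hessian u x *v v)" if "gradient u x \<bullet> v = 0" for v
        by (rule quasiconvex_tangential_hessian_nonneg[OF domain(1) x u1 u2[OF x] U_strict I(2) U_convex that])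
      show "gradient u x \<bullet> gradient u x + 2 * \<beta> * G (u x)
          \<le> gradient u y \<bullet> gradient u y + 2 * \<beta> * G (u y)" if "y \<in> \<Omega>" for y
        using min that x by (auto simp: Phi q_grad dot_square_norm)
    qed (use f_pos f'_le KJ admissible equation x in auto)
  qed
  have cpt_fr: "compact (frontier \<Omega>)" using domain by (simp add: compact_frontier_bounded)
  obtain y where y: "y \<in> frontier \<Omega>" "\<And>z. z \<in> frontier \<Omega> \<Longrightarrow> Phi \<alpha> f u \<Omega> y \<le> Phi \<alpha> f u \<Omega> z"
    using continuous_attains_inf[OF cpt_fr fr continuous_on_subset[OF cont_Phi fr_cl]] by blast
  have Phi_fr: "Phi \<beta> f u \<Omega> z = (norm (q z))\<^sup>2" if "z \<in> frontier \<Omega>" for z \<beta>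
    using boundary that by (simp add: Phi G0)
  \<comment> \<open>By \<open>Phi_fr\<close>, the point \<open>y\<close> chosen for
    \<open>\<alpha>\<close> minimises over the frontier for every \<open>\<beta>\<close>; and
    \<open>\<beta> > \<alpha>\<close> ensures \<open>\<beta> > 1\<close>, so the minimum over the
    closure lies on the frontier.\<close>
  have above: "Phi \<alpha> f u \<Omega> y \<le> Phi \<beta> f u \<Omega> x" if x: "x \<in> closure \<Omega>" and \<beta>: "\<alpha> < \<beta>" for x \<beta>
  proof -
    obtain z where z: "z \<in> closure \<Omega>" "\<And>x. x \<in> closure \<Omega> \<Longrightarrow> Phi \<beta> f u \<Omega> z \<le> Phi \<beta> f u \<Omega> x"
      using continuous_attains_inf[OF cpt cl_ne cont_Phi] by blast
    have "z \<notin> \<Omega>"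
      using no_interior_min[of z \<beta>] z(2) \<alpha> \<beta> closure_subset[of \<Omega>] by auto
    then have "z \<in> frontier \<Omega>" using z(1) domain(1) by (simp add: frontier_def interior_open)
    then have "Phi \<alpha> f u \<Omega> y \<le> Phi \<beta> f u \<Omega> z" using y(2)[of z] Phi_fr by simp
    then show ?thesis using z(2)[OF x] by linarith
  qed
  \<comment> \<open>At a fixed point the P-function is affine in its parameter, so the bound passes
    to the limit from the right.\<close>
  have "Phi \<alpha> f u \<Omega> y \<le> Phi \<alpha> f u \<Omega> x" if x: "x \<in> closure \<Omega>" for x
  proof (rule tendsto_lowerbound)
    show "((\<lambda>\<beta>. Phi \<beta> f u \<Omega> x) \<longlongrightarrow> Phi \<alpha> f u \<Omega> x) (at_right \<alpha>)"
      unfolding Phi by (intro tendsto_intros)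
    show "\<forall>\<^sub>F \<beta> in at_right \<alpha>. Phi \<alpha> f u \<Omega> y \<le> Phi \<beta> f u \<Omega> x"
      using eventually_at_right_less[of \<alpha>] by eventually_elim (rule above[OF x])
  qed simp
  then show ?thesis using y(1) by blast
qed

end
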